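(* The following equalities of subsets of $\mathcal{J}^1$ hold: (a) $\mathcal{H}(\mathbf{O})=Orb_{\mathrm{F}_{4(-20)}}(E_1)$; (b) $\mathcal{H}'(\mathbf{O})=Orb_{\mathrm{F}_{4(-20)}}(E_2)=Orb_{\mathrm{F}_{4(-20)}}(E_3)$; (c) $\mathcal{N}_1^+(\mathbf{O})=Orb_{\mathrm{F}_{4(-20)}}(P^+)$; (d) $\mathcal{N}_1^-(\mathbf{O})=Orb_{\mathrm{F}_{4(-20)}}(P^-)$; (e) $\mathcal{N}_2(\mathbf{O})=Orb_{\mathrm{F}_{4(-20)}}(Q^+(1))$.
   Context: Octonions. $\mathbf{O}$ is the real octonion algebra with basis $1=e_0,e_1,\dots,e_7$: $1$ is the unit, $e_i^2=-1$ and $e_ie_j=-e_je_i$ for distinct $i,j\ge 1$, and $e_le_m=e_n$, $e_me_n=e_l$, $e_ne_l=e_m$ for $(l,m,n)\in\{(1,2,3),(3,5,6),(6,7,1),(1,4,5),(3,4,7),(6,4,2),(2,5,7)\}$. For $x=\sum x_ie_i$, $y=\sum y_ie_i$: $\overline{x}=x_0-\sum_{i\ge1}x_ie_i$, $(x|y)=\sum x_iy_i$. $\mathbf{O}^{\mathbb{C}}=\mathbf{O}\otimes_{\mathbb{R}}\mathbb{C}$, with all operations extended $\mathbb{C}$-linearly. Jordan algebra. For $\xi\in\mathbb{R}^3$, $x\in\mathbf{O}^3$ put $h^1(\xi_1,\xi_2,\xi_3;x_1,x_2,x_3)=\begin{pmatrix}\xi_1&\sqrt{-1}x_3&\sqrt{-1}\,\overline{x_2}\\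 \sqrt{-1}\,\overline{x_3}&\xi_2&x_1\\ \sqrt{-1}x_2&\overline{x_1}&\xi_3\end{pmatrix}\in M(3,\mathbf{O}^{\mathbb{C}})$. $\mathcal{J}^1$ is the real vector space of all these matrices with Jordan product $X\circ Y=\frac12(XY+YX)$; $E$ is the identity matrix, $E_i$ the diagonal matrix with $1$ in position $(i,i)$ and $0$ elsewhere. $\mathrm{tr}(X)=\xi_1+\xi_2+\xi_3$, $(X|Y)=\mathrm{tr}(X\circ Y)$, $X\times Y=\frac12\bigl(2X\circ Y-\mathrm{tr}(X)Y-\mathrm{tr}(Y)X+(\mathrm{tr}(X)\mathrm{tr}(Y)-(X|Y))E\bigr)$, $X^{\times2}=X\times X$, $\det(X)=\frac13(X|X\times X)$. Group. $\mathrm{F}_{4(-20)}=\{g\in\mathrm{GL}_{\mathbb{R}}(\mathcal{J}^1)\mid g(X\circ Y)=gX\circ gY\ \text{for all }X,Y\in\mathcal{J}^1\}$, and $Orb_G(v)=\{gv\mid g\in G\}$. Elements. $P^+=h^1(1,-1,0;0,0,1)$, $P^-=h^1(-1,1,0;0,0,1)$, $Q^+(x)=h^1(0,0,0;x,\overline{x},0)$ for $x\in\mathbf{O}$. Subsets of $\mathcal{J}^1$. $\mathcal{H}(\mathbf{O})=\{X\mid X^{\times2}=0,\ \mathrm{tr}(X)=1,\ (X|E_1)\ge1\}$; $\mathcal{H}'(\mathbf{O})=\{X\mid X^{\times2}=0,\ \mathrm{tr}(X)=1,\ (X|E_1)\le0\}$; $\mathcal{N}_1^+(\mathbf{O})=\{X\mid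 X^{\times2}=0,\ \mathrm{tr}(X)=0,\ (X|E_1)>0\}$; $\mathcal{N}_1^-(\mathbf{O})=\{X\mid X^{\times2}=0,\ \mathrm{tr}(X)=0,\ (X|E_1)<0\}$; $\mathcal{N}_2(\mathbf{O})=\{X\mid \mathrm{tr}(X)=\mathrm{tr}(X^{\times2})=\det(X)=0,\ X^{\times2}\ne0\}$. *)

theory Defs
  imports "HOL-Analysis.Analysis"
begin

text \<open>
  An octonion with coefficients in a commutative ring \<open>'a\<close> is its coordinate vector
  in \<open>'a ^ 8\<close>, component \<open>i\<close> being the coefficient of \<open>e\<^sub>i\<close> for \<open>i = 0, \<dots>, 7\<close>
  (in the index type \<open>8\<close> the numerals \<open>0, \<dots>, 7\<close> are distinct).
  With \<open>'a = real\<close> this is \<open>\<^bold>O\<close>, and with \<open>'a = complex\<close> it is \<open>\<^bold>O\<close> tensored with the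
  complex numbers; the operations are the complex-linear extensions because they are given
  by the same structure constants. The componentwise product \<open>*\<close> which the library puts
  on vectors is never used on octonions.
\<close>

type_synonym 'a oct = "'a ^ 8"

definition oct_triples :: "(8 \<times> 8 \<times> 8) set" where
  "oct_triples = {(1,2,3), (3,5,6), (6,7,1), (1,4,5), (3,4,7), (6,4,2), (2,5,7)}"

text \<open>
  \<open>oct_cyc l m n\<close> holds iff \<open>(l, m, n)\<close> is a cyclic rotation of a listed triple, that is,
  iff \<open>l, m, n\<close> are imaginary indices with \<open>e\<^sub>l e\<^sub>m = e\<^sub>n\<close>.
\<close>

definition oct_cyc :: "8 \<Rightarrow> 8 \<Rightarrow> 8 \<Rightarrow> bool" where
  "oct_cyc l m n \<longleftrightarrow>
     (l, m, n) \<in> oct_triples \<or> (m, n, l) \<in> oct_triples \<or> (n, l, m) \<in> oct_triples"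

text \<open>\<open>oct_coeff i j k\<close> is the coefficient of \<open>e\<^sub>k\<close> in \<open>e\<^sub>i e\<^sub>j\<close>.\<close>

definition oct_coeff :: "8 \<Rightarrow> 8 \<Rightarrow> 8 \<Rightarrow> int" where
  "oct_coeff i j k =
     (if i = 0 then (if k = j then 1 else 0)
      else if j = 0 then (if k = i then 1 else 0)
      else if i = j then (if k = 0 then - 1 else 0)
      else if oct_cyc i j k then 1
      else if oct_cyc j i k then - 1
      else 0)"

definition oct_mult :: "'a::comm_ring_1 oct \<Rightarrow> 'a oct \<Rightarrow> 'a oct" (infixl "\<star>" 70) where
  "x \<star> y = (\<chi> k. \<Sum>i\<in>UNIV. \<Sum>j\<in>UNIV. of_int (oct_coeff i j k) * x $ i * y $ j)"

definition oct_one :: "'a::comm_ring_1 oct" where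
  "oct_one = axis 0 1"

definition oct_cnj :: "'a::comm_ring_1 oct \<Rightarrow> 'a oct" where
  "oct_cnj x = (\<chi> i. if i = 0 then x $ 0 else - x $ i)"

text \<open>The inclusion of \<open>\<^bold>O\<close> into its complexification.\<close>

definition oct_complex :: "real oct \<Rightarrow> complex oct" where
  "oct_complex x = (\<chi> i. complex_of_real (x $ i))"

type_synonym omat = "complex oct ^ 3 ^ 3"

definition omat_mult :: "omat \<Rightarrow> omat \<Rightarrow> omat" where
  "omat_mult X Y = (\<chi> i j. \<Sum>k\<in>UNIV. X $ i $ k \<star> Y $ k $ j)"

definition h1 :: "real \<Rightarrow> real \<Rightarrow> real \<Rightarrow> real oct \<Rightarrow> real oct \<Rightarrow> real oct \<Rightarrow> omat" where
  "h1 \<xi>1 \<xi>2 \<xi>3 x1 x2 x3 = vector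
     [vector [complex_of_real \<xi>1 *s oct_one, \<i> *s oct_complex x3, \<i> *s oct_complex (oct_cnj x2)],
      vector [\<i> *s oct_complex (oct_cnj x3), complex_of_real \<xi>2 *s oct_one, oct_complex x1],
      vector [\<i> *s oct_complex x2, oct_complex (oct_cnj x1), complex_of_real \<xi>3 *s oct_one]]"

definition J1 :: "omat set" where
  "J1 = {h1 \<xi>1 \<xi>2 \<xi>3 x1 x2 x3 |\<xi>1 \<xi>2 \<xi>3 x1 x2 x3. True}"

definition jordan :: "omat \<Rightarrow> omat \<Rightarrow> omat" (infixl "\<circ>\<^sub>J" 70) where
  "X \<circ>\<^sub>J Y = (1/2) *\<^sub>R (omat_mult X Y + omat_mult Y X)"

definition E :: omat where
  "E = mat oct_one"

definition E_diag :: "3 \<Rightarrow> omat" where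
  "E_diag i = (\<chi> j k. if j = i \<and> k = i then oct_one else 0)"

text \<open>
  On \<open>J1\<close> the diagonal entries are real multiples of the unit octonion, so taking the
  real part of the \<open>e\<^sub>0\<close>-coordinate loses nothing; see \<open>tr_h1\<close> below. All functions
  that follow are meaningful only on \<open>J1\<close>.
\<close>

definition tr :: "omat \<Rightarrow> real" where
  "tr X = Re ((\<Sum>i\<in>UNIV. X $ i $ i) $ 0)"

definition jform :: "omat \<Rightarrow> omat \<Rightarrow> real" where
  "jform X Y = tr (X \<circ>\<^sub>J Y)"

definition cross :: "omat \<Rightarrow> omat \<Rightarrow> omat" (infixl "\<times>\<^sub>J" 70) where
  "X \<times>\<^sub>J Y = (1/2) *\<^sub>R (2 *\<^sub>R (X \<circ>\<^sub>J Y) - tr X *\<^sub>R Y - tr Y *\<^sub>R X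
                      + (tr X * tr Y - jform X Y) *\<^sub>R E)"

definition jdet :: "omat \<Rightarrow> real" where
  "jdet X = (1/3) * jform X (X \<times>\<^sub>J X)"

text \<open>
  Maps \<open>J1 \<rightarrow> J1\<close> are represented by functions on the ambient matrix type that are
  \<open>undefined\<close> outside \<open>J1\<close>, so that distinct elements of the set below are distinct
  maps on \<open>J1\<close>.
\<close>

definition GL_J1 :: "(omat \<Rightarrow> omat) set" where
  "GL_J1 = {g \<in> extensional J1. bij_betw g J1 J1 \<and>
              (\<forall>X\<in>J1. \<forall>Y\<in>J1. g (X + Y) = g X + g Y) \<and>
              (\<forall>c::real. \<forall>X\<in>J1. g (c *\<^sub>R X) = c *\<^sub>R g X)}"

definition F4_m20 :: "(omat \<Rightarrow> omat) set" where
  "F4_m20 = {g \<in> GL_J1. \<forall>X\<in>J1. \<forall>Y\<in>J1. g (X \<circ>\<^sub>J Y) = g X \<circ>\<^sub>J g Y}"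

definition Orb :: "('a \<Rightarrow> 'a) set \<Rightarrow> 'a \<Rightarrow> 'a set" where
  "Orb G v = {g v |g. g \<in> G}"

definition P_plus :: omat where
  "P_plus = h1 1 (- 1) 0 0 0 oct_one"

definition P_minus :: omat where
  "P_minus = h1 (- 1) 1 0 0 0 oct_one"

definition Q_plus :: "real oct \<Rightarrow> omat" where
  "Q_plus x = h1 0 0 0 x (oct_cnj x) 0"

definition H_O :: "omat set" where
  "H_O = {X \<in> J1. X \<times>\<^sub>J X = 0 \<and> tr X = 1 \<and> jform X (E_diag 1) \<ge> 1}"

definition H'_O :: "omat set" where
  "H'_O = {X \<in> J1. X \<times>\<^sub>J X = 0 \<and> tr X = 1 \<and> jform X (E_diag 1) \<le> 0}"

definition N1_plus :: "omat set" where
  "N1_plus = {X \<in> J1. X \<times>\<^sub>J X = 0 \<and> tr X = 0 \<and> jform X (E_diag 1) > 0}"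

definition N1_minus :: "omat set" where
  "N1_minus = {X \<in> J1. X \<times>\<^sub>J X = 0 \<and> tr X = 0 \<and> jform X (E_diag 1) < 0}"

definition N2 :: "omat set" where
  "N2 = {X \<in> J1. tr X = 0 \<and> tr (X \<times>\<^sub>J X) = 0 \<and> jdet X = 0 \<and> X \<times>\<^sub>J X \<noteq> 0}"

lemma tr_h1: "tr (h1 \<xi>1 \<xi>2 \<xi>3 x1 x2 x3) = \<xi>1 + \<xi>2 + \<xi>3"
  by (simp add: tr_def h1_def sum_3 oct_one_def axis_def)

end

theory Submission
  imports Defs
begin

text \<open>
  Two families of explicit involutive automorphisms suffice for transitivity: conjugation by a Hermitian
  involution in the rows 2, 3 with an octonionic off-diagonal entry, and by a Lorentzian one with real
  parameters in the rows 1, 2. If \<open>X \<times> X = 0\<close>, the first family kills \<open>x1\<close> and then \<open>\<xi>3, x2\<close>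
  and makes \<open>x3\<close> real, and a boost in \<open>(\<xi>1 - \<xi>2, x3)\<close> gives the normal form. If \<open>X\<close> lies in \<open>\<N>\<^sub>2\<close>, then
  \<open>X \<times> X\<close> is null of trace 0, so it can be moved to \<open>P\<^sup>+\<close> or \<open>P\<^sup>-\<close>; solving \<open>X \<times> X = P\<^sup>\<plusminus>\<close> leaves only \<open>P\<^sup>-\<close>
  and \<open>X = Q\<^sup>+(x) + a P\<^sup>-\<close> with \<open>|x| = 1\<close>.

  Conversely, every automorphism preserves \<open>tr\<close>, because the kernel of \<open>tr\<close> is spanned by associators, and
  hence \<open>( | )\<close>, \<open>\<times>\<close> and \<open>det\<close>. The sign conditions are preserved because \<open>E\<^sub>1\<close> and \<open>E\<^sub>2\<close> are not
  conjugate (their Peirce 0-spaces have different signatures) and because \<open>(P\<^sup>+ | Z) \<ge> 0\<close> for \<open>Z\<close> in the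
  orbit of \<open>E\<^sub>1\<close>.
\<close>

section \<open>Octonions\<close>

lemma exhaust_8:
  fixes x :: 8
  shows "x = 0 \<or> x = 1 \<or> x = 2 \<or> x = 3 \<or> x = 4 \<or> x = 5 \<or> x = 6 \<or> x = 7"
proof (induct x)
  case (of_int z)
  then have "0 \<le> z" and "z < 8" by simp_all
  then have "z = 0 \<or> z = 1 \<or> z = 2 \<or> z = 3 \<or> z = 4 \<or> z = 5 \<or> z = 6 \<or> z = 7" by arith
  then show ?case by (metis of_int_0 of_int_1 of_int_numeral)
qed

lemma UNIV_8: "(UNIV :: 8 set) = {0, 1, 2, 3, 4, 5, 6, 7}"
  using exhaust_8 by blast

lemma sum_8: "sum f (UNIV :: 8 set) = f 0 + f 1 + f 2 + f 3 + f 4 + f 5 + f 6 + f 7"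
  unfolding UNIV_8 by (simp add: ac_simps)

lemma oct_eq_iff:
  fixes x y :: "'a oct"
  shows "x = y \<longleftrightarrow> x$0 = y$0 \<and> x$1 = y$1 \<and> x$2 = y$2 \<and> x$3 = y$3 \<and>
    x$4 = y$4 \<and> x$5 = y$5 \<and> x$6 = y$6 \<and> x$7 = y$7"
proof -
  have "x = y \<longleftrightarrow> (\<forall>i\<in>UNIV. x$i = y$i)" by (simp add: vec_eq_iff)
  then show ?thesis unfolding UNIV_8 by simp
qed

lemma oct_cyc_table:
  shows
    "oct_cyc 1 2 k \<longleftrightarrow> k = 3" "oct_cyc 1 3 k \<longleftrightarrow> False" "oct_cyc 1 4 k \<longleftrightarrow> k = 5"
    "oct_cyc 1 5 k \<longleftrightarrow> False" "oct_cyc 1 6 k \<longleftrightarrow> k = 7" "oct_cyc 1 7 k \<longleftrightarrow> False"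
    "oct_cyc 2 1 k \<longleftrightarrow> False" "oct_cyc 2 3 k \<longleftrightarrow> k = 1" "oct_cyc 2 4 k \<longleftrightarrow> False"
    "oct_cyc 2 5 k \<longleftrightarrow> k = 7" "oct_cyc 2 6 k \<longleftrightarrow> k = 4" "oct_cyc 2 7 k \<longleftrightarrow> False"
    "oct_cyc 3 1 k \<longleftrightarrow> k = 2" "oct_cyc 3 2 k \<longleftrightarrow> False" "oct_cyc 3 4 k \<longleftrightarrow> k = 7"
    "oct_cyc 3 5 k \<longleftrightarrow> k = 6" "oct_cyc 3 6 k \<longleftrightarrow> False" "oct_cyc 3 7 k \<longleftrightarrow> False"
    "oct_cyc 4 1 k \<longleftrightarrow> False" "oct_cyc 4 2 k \<longleftrightarrow> k = 6" "oct_cyc 4 3 k \<longleftrightarrow> False"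
    "oct_cyc 4 5 k \<longleftrightarrow> k = 1" "oct_cyc 4 6 k \<longleftrightarrow> False" "oct_cyc 4 7 k \<longleftrightarrow> k = 3"
    "oct_cyc 5 1 k \<longleftrightarrow> k = 4" "oct_cyc 5 2 k \<longleftrightarrow> False" "oct_cyc 5 3 k \<longleftrightarrow> False"
    "oct_cyc 5 4 k \<longleftrightarrow> False" "oct_cyc 5 6 k \<longleftrightarrow> k = 3" "oct_cyc 5 7 k \<longleftrightarrow> k = 2"
    "oct_cyc 6 1 k \<longleftrightarrow> False" "oct_cyc 6 2 k \<longleftrightarrow> False" "oct_cyc 6 3 k \<longleftrightarrow> k = 5"
    "oct_cyc 6 4 k \<longleftrightarrow> k = 2" "oct_cyc 6 5 k \<longleftrightarrow> False" "oct_cyc 6 7 k \<longleftrightarrow> k = 1"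
    "oct_cyc 7 1 k \<longleftrightarrow> k = 6" "oct_cyc 7 2 k \<longleftrightarrow> k = 5" "oct_cyc 7 3 k \<longleftrightarrow> k = 4"
    "oct_cyc 7 4 k \<longleftrightarrow> False" "oct_cyc 7 5 k \<longleftrightarrow> False" "oct_cyc 7 6 k \<longleftrightarrow> False"
  by (simp_all add: oct_cyc_def oct_triples_def)

text \<open>The structure constants are expanded once into coordinate polynomials. A few basic
  identities are checked on these; the others follow by adjoints, conjugation and
  polarisation.\<close>

lemma oct_mult_nth:
  fixes x y :: "'a::comm_ring_1 oct"
  shows
    "(x \<star> y)$0 = x$0*y$0 - x$1*y$1 - x$2*y$2 - x$3*y$3 - x$4*y$4 - x$5*y$5 - x$6*y$6 - x$7*y$7"
    "(x \<star> y)$1 = x$0*y$1 + x$1*y$0 + x$2*y$3 - x$3*y$2 + x$4*y$5 - x$5*y$4 + x$6*y$7 - x$7*y$6"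
    "(x \<star> y)$2 = x$0*y$2 - x$1*y$3 + x$2*y$0 + x$3*y$1 - x$4*y$6 + x$5*y$7 + x$6*y$4 - x$7*y$5"
    "(x \<star> y)$3 = x$0*y$3 + x$1*y$2 - x$2*y$1 + x$3*y$0 + x$4*y$7 + x$5*y$6 - x$6*y$5 - x$7*y$4"
    "(x \<star> y)$4 = x$0*y$4 - x$1*y$5 + x$2*y$6 - x$3*y$7 + x$4*y$0 + x$5*y$1 - x$6*y$2 + x$7*y$3"
    "(x \<star> y)$5 = x$0*y$5 + x$1*y$4 - x$2*y$7 - x$3*y$6 - x$4*y$1 + x$5*y$0 + x$6*y$3 + x$7*y$2"
    "(x \<star> y)$6 = x$0*y$6 - x$1*y$7 - x$2*y$4 + x$3*y$5 + x$4*y$2 - x$5*y$3 + x$6*y$0 + x$7*y$1"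
    "(x \<star> y)$7 = x$0*y$7 + x$1*y$6 + x$2*y$5 + x$3*y$4 - x$4*y$3 - x$5*y$2 - x$6*y$1 + x$7*y$0"
  by (simp_all add: oct_mult_def sum_8 oct_coeff_def oct_cyc_table)

lemma oct_cnj_nth:
  fixes x :: "'a::comm_ring_1 oct"
  shows "oct_cnj x $ 0 = x$0" "oct_cnj x $ 1 = - x$1" "oct_cnj x $ 2 = - x$2" "oct_cnj x $ 3 = - x$3"
    "oct_cnj x $ 4 = - x$4" "oct_cnj x $ 5 = - x$5" "oct_cnj x $ 6 = - x$6" "oct_cnj x $ 7 = - x$7"
  by (simp_all add: oct_cnj_def)

lemma oct_one_nth:
  "(oct_one :: 'a::comm_ring_1 oct) $ 0 = 1" "(oct_one :: 'a oct) $ 1 = 0" "(oct_one :: 'a oct) $ 2 = 0"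
  "(oct_one :: 'a oct) $ 3 = 0" "(oct_one :: 'a oct) $ 4 = 0" "(oct_one :: 'a oct) $ 5 = 0"
  "(oct_one :: 'a oct) $ 6 = 0" "(oct_one :: 'a oct) $ 7 = 0"
  by (simp_all add: oct_one_def axis_def)

lemma oct_inner:
  fixes x y :: "real oct"
  shows "x \<bullet> y = x$0*y$0 + x$1*y$1 + x$2*y$2 + x$3*y$3 + x$4*y$4 + x$5*y$5 + x$6*y$6 + x$7*y$7"
  by (simp add: inner_vec_def sum_8)

section \<open>Bilinearity and conjugation\<close>

lemma oct_mult_add:
  fixes x y z :: "'a::comm_ring_1 oct"
  shows "x \<star> (y + z) = x \<star> y + x \<star> z" "(y + z) \<star> x = y \<star> x + z \<star> x"
  by (simp_all add: vec_eq_iff oct_mult_def algebra_simps sum.distrib)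

lemma oct_mult_smult:
  fixes x y :: "'a::comm_ring_1 oct"
  shows "x \<star> (c *s y) = c *s (x \<star> y)" "(c *s x) \<star> y = c *s (x \<star> y)"
  by (simp_all add: vec_eq_iff oct_mult_def algebra_simps sum_distrib_left)

lemma oct_mult_scaleR:
  fixes x y :: "real oct"
  shows "x \<star> (c *\<^sub>R y) = c *\<^sub>R (x \<star> y)" "(c *\<^sub>R x) \<star> y = c *\<^sub>R (x \<star> y)"
  by (simp_all add: vec_eq_iff oct_mult_def algebra_simps sum_distrib_left)

lemma oct_mult_zero [simp]:
  fixes x :: "'a::comm_ring_1 oct"
  shows "x \<star> 0 = 0" "0 \<star> x = 0"
  by (simp_all add: vec_eq_iff oct_mult_def)

lemma oct_mult_minus [simp]:
  fixes x y :: "'a::comm_ring_1 oct"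
  shows "x \<star> (- y) = - (x \<star> y)" "(- x) \<star> y = - (x \<star> y)"
  by (simp_all add: vec_eq_iff oct_mult_def sum_negf)

lemma oct_mult_diff:
  fixes x y z :: "'a::comm_ring_1 oct"
  shows "x \<star> (y - z) = x \<star> y - x \<star> z" "(y - z) \<star> x = y \<star> x - z \<star> x"
  using oct_mult_add[of x y "- z"] oct_mult_add[of y "- z" x] by simp_all

lemma oct_mult_one [simp]:
  fixes x :: "'a::comm_ring_1 oct"
  shows "x \<star> oct_one = x" "oct_one \<star> x = x"
  by (simp_all add: oct_eq_iff oct_mult_nth oct_one_nth)

lemma oct_cnj_linear [simp]:
  fixes x y :: "'a::comm_ring_1 oct"
  shows "oct_cnj (x + y) = oct_cnj x + oct_cnj y" "oct_cnj (x - y) = oct_cnj x - oct_cnj y"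
    "oct_cnj (- x) = - oct_cnj x" "oct_cnj 0 = (0 :: 'a oct)" "oct_cnj (c *s x) = c *s oct_cnj x"
    "oct_cnj (oct_cnj x) = x" "oct_cnj oct_one = (oct_one :: 'a oct)"
  by (simp_all add: vec_eq_iff oct_cnj_def oct_one_def axis_def)

lemma oct_cnj_scaleR [simp]: "oct_cnj (c *\<^sub>R x) = c *\<^sub>R oct_cnj (x :: real oct)"
  by (simp add: vec_eq_iff oct_cnj_def)

lemma oct_cnj_mult:
  fixes x y :: "'a::comm_ring_1 oct"
  shows "oct_cnj (x \<star> y) = oct_cnj y \<star> oct_cnj x"
  by (simp add: oct_eq_iff oct_mult_nth oct_cnj_nth algebra_simps)

lemma oct_add_cnj: "x + oct_cnj x = (2 * (x \<bullet> oct_one)) *\<^sub>R (oct_one :: real oct)"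
  by (simp add: oct_eq_iff oct_cnj_nth oct_one_nth oct_inner)

lemma inner_cnj [simp]: "oct_cnj x \<bullet> oct_cnj y = x \<bullet> (y :: real oct)"
  by (simp add: oct_inner oct_cnj_nth)

lemma inner_cnj_swap: "oct_cnj x \<bullet> y = x \<bullet> oct_cnj (y :: real oct)"
  by (simp add: oct_inner oct_cnj_nth)

lemma inner_oct_one_one [simp]: "(oct_one :: real oct) \<bullet> oct_one = 1"
  by (simp add: oct_inner oct_one_nth)

lemma norm_oct_one [simp]: "norm (oct_one :: real oct) = 1"
  by (simp add: norm_eq_sqrt_inner)

section \<open>Adjoints of multiplications, alternativity and the composition law\<close>

lemma inner_oct_mult_left: "(x \<star> y) \<bullet> z = y \<bullet> (oct_cnj x \<star> (z :: real oct))"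
  by (simp add: oct_inner oct_mult_nth oct_cnj_nth algebra_simps)

lemma inner_oct_mult_right: "(x \<star> y) \<bullet> z = x \<bullet> ((z :: real oct) \<star> oct_cnj y)"
  by (simp add: oct_inner oct_mult_nth oct_cnj_nth algebra_simps)

text \<open>Alternativity and multiplicativity of the norm in one formula; it substitutes for the
  missing associativity.\<close>

lemma oct_cnj_mult_self_left: "oct_cnj x \<star> (x \<star> y) = (x \<bullet> x) *\<^sub>R (y :: real oct)"
  unfolding oct_eq_iff oct_inner oct_mult_nth oct_cnj_nth vector_scaleR_component real_scaleR_def
  by (intro conjI; algebra)

lemma oct_cnj_mult_self_right: "(y \<star> x) \<star> oct_cnj x = (x \<bullet> x) *\<^sub>R (y :: real oct)"
  using arg_cong[OF oct_cnj_mult_self_left[of "oct_cnj x" "oct_cnj y"], of oct_cnj]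
  by (simp add: oct_cnj_mult)

lemma oct_mult_cnj_self_left: "x \<star> (oct_cnj x \<star> y) = (x \<bullet> x) *\<^sub>R (y :: real oct)"
  using oct_cnj_mult_self_left[of "oct_cnj x" y] by simp

lemma oct_mult_cnj_self_right: "(y \<star> oct_cnj x) \<star> x = (x \<bullet> x) *\<^sub>R (y :: real oct)"
  using oct_cnj_mult_self_right[of y "oct_cnj x"] by simp

text \<open>Linearisation in \<open>x\<close> of \<open>oct_cnj_mult_self_right\<close>: it
  interchanges two factors that do not associate, at the cost of a scalar multiple of
  \<open>z\<close>.\<close>

lemma oct_mult_cnj_polar:
  "(z \<star> x) \<star> oct_cnj y + (z \<star> y) \<star> oct_cnj x = (2 * (x \<bullet> y)) *\<^sub>R (z :: real oct)"
  using oct_cnj_mult_self_right[of z "x + y"]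
  by (simp add: oct_mult_add oct_cnj_mult_self_right inner_add inner_commute[of y x] algebra_simps)

lemma oct_mult_cnj_polar_left:
  "x \<star> (oct_cnj y \<star> z) + y \<star> (oct_cnj x \<star> z) = (2 * (x \<bullet> y)) *\<^sub>R (z :: real oct)"
  using oct_mult_cnj_self_left[of "x + y" z]
  by (simp add: oct_mult_add oct_mult_cnj_self_left inner_add inner_commute[of y x] algebra_simps)

lemma oct_mult_cnj: "x \<star> oct_cnj x = (x \<bullet> x) *\<^sub>R (oct_one :: real oct)"
  using oct_mult_cnj_self_left[of x oct_one] by simp

lemma oct_cnj_mult_self: "oct_cnj x \<star> x = (x \<bullet> x) *\<^sub>R (oct_one :: real oct)"
  using oct_cnj_mult_self_left[of x oct_one] by simp

lemma oct_mult_cnj_add: "x \<star> oct_cnj y + y \<star> oct_cnj x = (2 * (x \<bullet> y)) *\<^sub>R (oct_one :: real oct)"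
  using oct_mult_cnj_polar[of oct_one x y] by simp

lemma inner_oct_mult_self_left: "(x \<star> y) \<bullet> (x \<star> z) = (x \<bullet> x) * (y \<bullet> (z :: real oct))"
  by (simp add: inner_oct_mult_left oct_cnj_mult_self_left)

lemma inner_oct_mult_self_right: "(y \<star> x) \<bullet> (z \<star> x) = (x \<bullet> x) * (y \<bullet> (z :: real oct))"
  by (simp add: inner_oct_mult_right oct_cnj_mult_self_right)

lemma inner_oct_mult_polar:
  "(a \<star> x) \<bullet> (b \<star> y) + (b \<star> x) \<bullet> (a \<star> y) = 2 * (a \<bullet> b) * (x \<bullet> (y :: real oct))"
  using inner_oct_mult_self_left[of "a + b" x y]
  by (simp add: inner_oct_mult_self_left oct_mult_add inner_add algebra_simps inner_commute[of b a])

text \<open>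
  The middle Moufang identity \<open>(a x) (y a) = a (x y) a\<close>, with the right-hand side expanded.
\<close>

lemma oct_moufang:
  fixes a x y :: "real oct"
  shows "(a \<star> x) \<star> (y \<star> a) = (2 * (a \<bullet> oct_cnj (x \<star> y))) *\<^sub>R a - (a \<bullet> a) *\<^sub>R oct_cnj (x \<star> y)"
proof -
  \<comment> \<open>Tested against an arbitrary \<open>z\<close>: adjoints move the right-hand
    factor over, the polarised composition law exchanges \<open>a\<close> and \<open>z\<close>, and
    then \<open>a\<close> meets its conjugate.\<close>
  have "((a \<star> x) \<star> (y \<star> a)) \<bullet> z
      = ((2 * (a \<bullet> oct_cnj (x \<star> y))) *\<^sub>R a - (a \<bullet> a) *\<^sub>R oct_cnj (x \<star> y)) \<bullet> z" for z
  proof -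
    have "((a \<star> x) \<star> (y \<star> a)) \<bullet> z = (a \<star> x) \<bullet> (z \<star> (oct_cnj a \<star> oct_cnj y))"
      by (simp add: inner_oct_mult_right oct_cnj_mult)
    also have "\<dots> = 2 * (a \<bullet> z) * (x \<bullet> (oct_cnj a \<star> oct_cnj y)) - (z \<star> x) \<bullet> (a \<star> (oct_cnj a \<star> oct_cnj y))"
      using inner_oct_mult_polar[of a x z "oct_cnj a \<star> oct_cnj y"] by simp
    also have "x \<bullet> (oct_cnj a \<star> oct_cnj y) = a \<bullet> oct_cnj (x \<star> y)"
      by (metis inner_oct_mult_left inner_oct_mult_right oct_cnj_mult)
    also have "(z \<star> x) \<bullet> (a \<star> (oct_cnj a \<star> oct_cnj y)) = (a \<bullet> a) * (oct_cnj (x \<star> y) \<bullet> z)"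
      by (simp add: oct_mult_cnj_self_left oct_cnj_mult) (metis inner_oct_mult_right inner_commute)
    finally show ?thesis
      by (simp add: inner_diff_left)
  qed
  then show ?thesis by (metis vector_eq_rdot)
qed

section \<open>The Jordan algebra in coordinates\<close>

lemma oct_complex_add: "oct_complex x + oct_complex y = oct_complex (x + y)"
  by (simp add: oct_complex_def vec_eq_iff)

lemma oct_complex_scaleR: "c *\<^sub>R oct_complex x = oct_complex (c *\<^sub>R x)"
  by (simp only: oct_complex_def vec_eq_iff vector_scaleR_component vector_smult_component vec_lambda_beta
      real_scaleR_def, simp only: scaleR_conv_of_real[where 'a=complex] of_real_mult mult.left_commute simp_thms)

lemma oct_complex_one: "complex_of_real c *s oct_one = oct_complex (c *\<^sub>R oct_one)"
  by (simp add: oct_complex_def vec_eq_iff oct_one_def axis_def)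

lemma oct_complex_mult: "oct_complex x \<star> oct_complex y = oct_complex (x \<star> y)"
  by (simp add: oct_complex_def vec_eq_iff oct_mult_def)

lemma oct_ii_complex: "\<i> *s (\<i> *s oct_complex x) = oct_complex (- x)"
  by (simp only: oct_complex_def vec_eq_iff vector_smult_component vec_lambda_beta
      vector_uminus_component mult.assoc[symmetric]) simp

lemma oct_complex_eq_iff [simp]: "oct_complex x = oct_complex y \<longleftrightarrow> x = y"
  by (simp add: oct_complex_def vec_eq_iff)

lemma oct_i_complex_add: "\<i> *s oct_complex x + \<i> *s oct_complex y = \<i> *s oct_complex (x + y)"
  by (simp add: oct_complex_def vec_eq_iff algebra_simps)

lemma oct_i_complex_scaleR: "c *\<^sub>R (\<i> *s oct_complex x) = \<i> *s oct_complex (c *\<^sub>R x)"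
  by (simp only: oct_complex_def vec_eq_iff vector_scaleR_component vector_smult_component vec_lambda_beta
      real_scaleR_def, simp only: scaleR_conv_of_real[where 'a=complex] of_real_mult mult.left_commute simp_thms)

lemma oct_i_complex_eq_iff [simp]: "\<i> *s oct_complex x = \<i> *s oct_complex y \<longleftrightarrow> x = y"
  by (simp add: oct_complex_def vec_eq_iff)

lemma h1_nth:
  "h1 a1 a2 a3 x1 x2 x3 $ 1 $ 1 = oct_complex (a1 *\<^sub>R oct_one)"
  "h1 a1 a2 a3 x1 x2 x3 $ 1 $ 2 = \<i> *s oct_complex x3"
  "h1 a1 a2 a3 x1 x2 x3 $ 1 $ 3 = \<i> *s oct_complex (oct_cnj x2)"
  "h1 a1 a2 a3 x1 x2 x3 $ 2 $ 1 = \<i> *s oct_complex (oct_cnj x3)"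
  "h1 a1 a2 a3 x1 x2 x3 $ 2 $ 2 = oct_complex (a2 *\<^sub>R oct_one)"
  "h1 a1 a2 a3 x1 x2 x3 $ 2 $ 3 = oct_complex x1"
  "h1 a1 a2 a3 x1 x2 x3 $ 3 $ 1 = \<i> *s oct_complex x2"
  "h1 a1 a2 a3 x1 x2 x3 $ 3 $ 2 = oct_complex (oct_cnj x1)"
  "h1 a1 a2 a3 x1 x2 x3 $ 3 $ 3 = oct_complex (a3 *\<^sub>R oct_one)"
  by (simp_all add: h1_def oct_complex_one)

lemma h1_eq_iff [simp]:
  "h1 a1 a2 a3 x1 x2 x3 = h1 b1 b2 b3 y1 y2 y3 \<longleftrightarrow>
     a1 = b1 \<and> a2 = b2 \<and> a3 = b3 \<and> x1 = y1 \<and> x2 = y2 \<and> x3 = y3"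
proof
  assume eq: "h1 a1 a2 a3 x1 x2 x3 = h1 b1 b2 b3 y1 y2 y3"
  have "oct_one \<noteq> (0 :: real oct)"
    using norm_oct_one by (metis norm_zero zero_neq_one)
  then show "a1 = b1 \<and> a2 = b2 \<and> a3 = b3 \<and> x1 = y1 \<and> x2 = y2 \<and> x3 = y3"
    using arg_cong[OF eq, of "\<lambda>X. X $ 1 $ 1"] arg_cong[OF eq, of "\<lambda>X. X $ 2 $ 2"]
      arg_cong[OF eq, of "\<lambda>X. X $ 3 $ 3"] arg_cong[OF eq, of "\<lambda>X. X $ 2 $ 3"]
      arg_cong[OF eq, of "\<lambda>X. X $ 3 $ 1"] arg_cong[OF eq, of "\<lambda>X. X $ 1 $ 2"]
    by (simp add: h1_nth)
qed simp

lemma h1_add: "h1 a1 a2 a3 x1 x2 x3 + h1 b1 b2 b3 y1 y2 y3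
    = h1 (a1 + b1) (a2 + b2) (a3 + b3) (x1 + y1) (x2 + y2) (x3 + y3)"
  by (simp add: vec_eq_iff[where 'b=3] forall_3 h1_nth oct_complex_add oct_i_complex_add scaleR_add_left)

lemma h1_scaleR: "c *\<^sub>R h1 a1 a2 a3 x1 x2 x3
    = h1 (c * a1) (c * a2) (c * a3) (c *\<^sub>R x1) (c *\<^sub>R x2) (c *\<^sub>R x3)"
  by (simp add: vec_eq_iff[where 'b=3] forall_3 h1_nth oct_complex_scaleR oct_i_complex_scaleR)

lemma h1_zero: "h1 0 0 0 0 0 0 = 0"
  using h1_scaleR[of 0 0 0 0 0 0 0] by simp

lemma h1_diff: "h1 a1 a2 a3 x1 x2 x3 - h1 b1 b2 b3 y1 y2 y3
    = h1 (a1 - b1) (a2 - b2) (a3 - b3) (x1 - y1) (x2 - y2) (x3 - y3)"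
  using h1_add[of "a1 - b1" "a2 - b2" "a3 - b3" "x1 - y1" "x2 - y2" "x3 - y3" b1 b2 b3 y1 y2 y3]
  by (simp add: algebra_simps)

lemma jordan_h1:
  "h1 a1 a2 a3 x1 x2 x3 \<circ>\<^sub>J h1 b1 b2 b3 y1 y2 y3 =
    h1 (a1 * b1 - x2 \<bullet> y2 - x3 \<bullet> y3) (a2 * b2 + x1 \<bullet> y1 - x3 \<bullet> y3) (a3 * b3 + x1 \<bullet> y1 - x2 \<bullet> y2)
      ((1/2) *\<^sub>R ((a2 + a3) *\<^sub>R y1 + (b2 + b3) *\<^sub>R x1 - oct_cnj (x2 \<star> y3 + y2 \<star> x3)))
      ((1/2) *\<^sub>R ((a3 + a1) *\<^sub>R y2 + (b3 + b1) *\<^sub>R x2 + oct_cnj (x3 \<star> y1 + y3 \<star> x1)))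
      ((1/2) *\<^sub>R ((a1 + a2) *\<^sub>R y3 + (b1 + b2) *\<^sub>R x3 + oct_cnj (x1 \<star> y2 + y1 \<star> x2)))"
proof -
  \<comment> \<open>Each diagonal entry of the symmetrised product contains both orders of a product
    with a conjugate; \<open>r\<close> rewrites one order so that the octonionic parts cancel and
    inner products remain.\<close>
  have r: "x3 \<star> oct_cnj y3 = (2 * (x3 \<bullet> y3)) *\<^sub>R oct_one - y3 \<star> oct_cnj x3"
    "oct_cnj x2 \<star> y2 = (2 * (x2 \<bullet> y2)) *\<^sub>R oct_one - oct_cnj y2 \<star> x2"
    "oct_cnj x3 \<star> y3 = (2 * (x3 \<bullet> y3)) *\<^sub>R oct_one - oct_cnj y3 \<star> x3"
    "x1 \<star> oct_cnj y1 = (2 * (x1 \<bullet> y1)) *\<^sub>R oct_one - y1 \<star> oct_cnj x1"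
    "x2 \<star> oct_cnj y2 = (2 * (x2 \<bullet> y2)) *\<^sub>R oct_one - y2 \<star> oct_cnj x2"
    "oct_cnj x1 \<star> y1 = (2 * (x1 \<bullet> y1)) *\<^sub>R oct_one - oct_cnj y1 \<star> x1"
    using oct_mult_cnj_add[of x1 y1] oct_mult_cnj_add[of x2 y2] oct_mult_cnj_add[of x3 y3]
      oct_mult_cnj_add[of "oct_cnj x1" "oct_cnj y1"] oct_mult_cnj_add[of "oct_cnj x2" "oct_cnj y2"]
      oct_mult_cnj_add[of "oct_cnj x3" "oct_cnj y3"]
    by (simp_all add: eq_diff_eq)
  show ?thesis
    unfolding vec_eq_iff[where 'b=3] forall_3
    apply (simp only: jordan_def omat_mult_def vector_scaleR_component vector_add_component
      vec_lambda_beta sum_3 h1_nth oct_complex_mult oct_mult_smult oct_ii_complex oct_complex_add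
      oct_i_complex_add oct_complex_scaleR oct_i_complex_scaleR oct_complex_eq_iff oct_i_complex_eq_iff
      oct_mult_scaleR oct_mult_one oct_cnj_mult oct_cnj_linear oct_cnj_scaleR r)
    by (intro conjI; simp only: vec_eq_iff vector_scaleR_component vector_add_component
      vector_minus_component vector_uminus_component real_scaleR_def; simp add: algebra_simps)
qed

lemma E_h1: "E = h1 1 1 1 0 0 0"
  by (simp add: vec_eq_iff[where 'b=3] forall_3 h1_nth E_def mat_def)
    (simp add: oct_complex_def oct_one_def axis_def vec_eq_iff)

lemma E_diag_h1: "E_diag 1 = h1 1 0 0 0 0 0" "E_diag 2 = h1 0 1 0 0 0 0" "E_diag 3 = h1 0 0 1 0 0 0"
  by (simp_all add: vec_eq_iff[where 'b=3] forall_3 h1_nth E_diag_def)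
    (simp_all add: oct_complex_def oct_one_def axis_def vec_eq_iff)

lemma h1_in_J1 [simp]: "h1 a1 a2 a3 x1 x2 x3 \<in> J1"
  by (auto simp: J1_def)

lemma J1_cases:
  assumes "X \<in> J1"
  obtains a1 a2 a3 x1 x2 x3 where "X = h1 a1 a2 a3 x1 x2 x3"
  using assms by (auto simp: J1_def)

lemma E_in_J1 [simp]: "E \<in> J1" and E_diag_in_J1 [simp]: "E_diag 1 \<in> J1" "E_diag 2 \<in> J1" "E_diag 3 \<in> J1"
  by (simp_all add: E_h1 E_diag_h1)

lemma J1_add [simp]: "X \<in> J1 \<Longrightarrow> Y \<in> J1 \<Longrightarrow> X + Y \<in> J1"
  by (auto elim!: J1_cases simp: h1_add)

lemma J1_scaleR [simp]: "X \<in> J1 \<Longrightarrow> c *\<^sub>R X \<in> J1"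
  by (auto elim!: J1_cases simp: h1_scaleR)

lemma J1_diff [simp]: "X \<in> J1 \<Longrightarrow> Y \<in> J1 \<Longrightarrow> X - Y \<in> J1"
  by (auto elim!: J1_cases simp: h1_diff)

lemma J1_jordan [simp]: "X \<in> J1 \<Longrightarrow> Y \<in> J1 \<Longrightarrow> X \<circ>\<^sub>J Y \<in> J1"
  by (auto elim!: J1_cases simp: jordan_h1)

lemma J1_cross [simp]: "X \<in> J1 \<Longrightarrow> Y \<in> J1 \<Longrightarrow> X \<times>\<^sub>J Y \<in> J1"
  by (simp add: cross_def)

lemma jordan_commute: "X \<circ>\<^sub>J Y = Y \<circ>\<^sub>J X"
  by (simp add: jordan_def add.commute)

lemma omat_mult_add: "omat_mult (X + Y) Z = omat_mult X Z + omat_mult Y Z"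
  "omat_mult Z (X + Y) = omat_mult Z X + omat_mult Z Y"
  by (simp_all add: omat_mult_def vec_eq_iff[where 'b=3] oct_mult_add sum.distrib)

lemma jordan_add: "(X + Y) \<circ>\<^sub>J Z = X \<circ>\<^sub>J Z + Y \<circ>\<^sub>J Z" "Z \<circ>\<^sub>J (X + Y) = Z \<circ>\<^sub>J X + Z \<circ>\<^sub>J Y"
  by (simp_all add: jordan_def omat_mult_add algebra_simps)

lemma jordan_E: "X \<in> J1 \<Longrightarrow> X \<circ>\<^sub>J E = X"
  by (elim J1_cases) (simp add: E_h1 jordan_h1 algebra_simps flip: scaleR_add_left)

lemma tr_add: "tr (X + Y) = tr X + tr Y"
  by (simp add: tr_def sum.distrib)

lemma tr_scaleR: "tr (c *\<^sub>R X) = c * tr X"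
  by (simp add: tr_def sum_3 algebra_simps)

lemma jform_h1: "jform (h1 a1 a2 a3 x1 x2 x3) (h1 b1 b2 b3 y1 y2 y3) =
    a1 * b1 + a2 * b2 + a3 * b3 + 2 * (x1 \<bullet> y1) - 2 * (x2 \<bullet> y2) - 2 * (x3 \<bullet> y3)"
  by (simp add: jform_def jordan_h1 tr_h1)

lemma jordan_self_h1: "h1 a1 a2 a3 x1 x2 x3 \<circ>\<^sub>J h1 a1 a2 a3 x1 x2 x3 =
    h1 (a1 * a1 - x2 \<bullet> x2 - x3 \<bullet> x3) (a2 * a2 + x1 \<bullet> x1 - x3 \<bullet> x3) (a3 * a3 + x1 \<bullet> x1 - x2 \<bullet> x2)
      ((a2 + a3) *\<^sub>R x1 - oct_cnj (x2 \<star> x3)) ((a3 + a1) *\<^sub>R x2 + oct_cnj (x3 \<star> x1))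
      ((a1 + a2) *\<^sub>R x3 + oct_cnj (x1 \<star> x2))"
  unfolding jordan_h1 scaleR_2[symmetric] oct_cnj_scaleR
  by (simp add: algebra_simps)

lemma cross_self_h1: "h1 a1 a2 a3 x1 x2 x3 \<times>\<^sub>J h1 a1 a2 a3 x1 x2 x3 =
    h1 (a2 * a3 - x1 \<bullet> x1) (a3 * a1 + x2 \<bullet> x2) (a1 * a2 + x3 \<bullet> x3)
      (- oct_cnj (x2 \<star> x3) - a1 *\<^sub>R x1) (oct_cnj (x3 \<star> x1) - a2 *\<^sub>R x2) (oct_cnj (x1 \<star> x2) - a3 *\<^sub>R x3)"
  by (simp add: cross_def jordan_self_h1 jform_h1 tr_h1 E_h1 h1_add h1_diff h1_scaleR)
    (simp add: vec_eq_iff field_simps)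

text \<open>The left-hand side is Re((xy)z), which is invariant under cyclic permutations although
  the product is not associative.\<close>

lemma inner_cnj_mult_cycle: "oct_cnj (x \<star> y) \<bullet> z = oct_cnj (y \<star> z) \<bullet> (x :: real oct)"
  by (metis inner_cnj_swap inner_commute inner_oct_mult_right oct_cnj_mult)

text \<open>Associativity of the trace form: terms with three off-diagonal entries are real parts of
  triple products and match by cyclicity; the others agree by plain algebra.\<close>

lemma tr_jordan_assoc:
  assumes "X \<in> J1" "Y \<in> J1" "Z \<in> J1"
  shows "tr ((X \<circ>\<^sub>J Y) \<circ>\<^sub>J Z) = tr (X \<circ>\<^sub>J (Y \<circ>\<^sub>J Z))"
proof -
  obtain a1 a2 a3 x1 x2 x3 where X: "X = h1 a1 a2 a3 x1 x2 x3" using assms(1) by (rule J1_cases)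
  obtain b1 b2 b3 y1 y2 y3 where Y: "Y = h1 b1 b2 b3 y1 y2 y3" using assms(2) by (rule J1_cases)
  obtain c1 c2 c3 z1 z2 z3 where Z: "Z = h1 c1 c2 c3 z1 z2 z3" using assms(3) by (rule J1_cases)
  note cyc = inner_cnj_mult_cycle[of x2 y3 z1] inner_cnj_mult_cycle[of y2 x3 z1]
    inner_cnj_mult_cycle[of x3 y1 z2] inner_cnj_mult_cycle[of y3 x1 z2]
    inner_cnj_mult_cycle[of x1 y2 z3] inner_cnj_mult_cycle[of y1 x2 z3]
    inner_cnj_mult_cycle[of x1 z2 y3] inner_cnj_mult_cycle[of x2 z3 y1] inner_cnj_mult_cycle[of x3 z1 y2]
  show ?thesis
    unfolding X Y Z jordan_h1 tr_h1
    using cyc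
    by (simp add: inner_add_left inner_add_right inner_diff_left inner_diff_right oct_cnj_mult
        algebra_simps inner_commute)
qed

section \<open>Automorphisms and their invariants\<close>

lemma F4_J1: "g \<in> F4_m20 \<Longrightarrow> X \<in> J1 \<Longrightarrow> g X \<in> J1"
  by (auto simp: F4_m20_def GL_J1_def bij_betw_def)

lemma F4_add: "g \<in> F4_m20 \<Longrightarrow> X \<in> J1 \<Longrightarrow> Y \<in> J1 \<Longrightarrow> g (X + Y) = g X + g Y"
  by (simp add: F4_m20_def GL_J1_def)

lemma F4_scaleR: "g \<in> F4_m20 \<Longrightarrow> X \<in> J1 \<Longrightarrow> g (c *\<^sub>R X) = c *\<^sub>R g X"
  by (simp add: F4_m20_def GL_J1_def)

lemma F4_jordan: "g \<in> F4_m20 \<Longrightarrow> X \<in> J1 \<Longrightarrow> Y \<in> J1 \<Longrightarrow> g (X \<circ>\<^sub>J Y) = g X \<circ>\<^sub>J g Y"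
  by (simp add: F4_m20_def)

lemma F4_bij: "g \<in> F4_m20 \<Longrightarrow> bij_betw g J1 J1"
  by (simp add: F4_m20_def GL_J1_def)

lemma F4_diff: "g \<in> F4_m20 \<Longrightarrow> X \<in> J1 \<Longrightarrow> Y \<in> J1 \<Longrightarrow> g (X - Y) = g X - g Y"
  using F4_add[of g X "(-1) *\<^sub>R Y"] F4_scaleR[of g Y "-1"] J1_scaleR[of Y "-1"] by simp

lemma F4_E:
  assumes g: "g \<in> F4_m20"
  shows "g E = E"
proof -
  obtain U where U: "U \<in> J1" "g U = E"
    using F4_bij[OF g] E_in_J1 by (metis bij_betw_imp_surj_on imageE)
  have "g E = g E \<circ>\<^sub>J g U"
    using jordan_E[OF F4_J1[OF g E_in_J1]] U by simp
  also have "\<dots> = g (U \<circ>\<^sub>J E)"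
    using F4_jordan[OF g, of E U] U(1) by (simp add: jordan_commute)
  finally show ?thesis
    using U by (simp add: jordan_E)
qed

text \<open>\<open>\<lambda>X. tr (g X)\<close> kills all associators \<open>(X \<circ> Y) \<circ> Z - X \<circ> (Y \<circ> Z)\<close>, and these span the kernel of \<open>tr\<close>.\<close>

lemma F4_tr:
  assumes g: "g \<in> F4_m20" and X: "X \<in> J1"
  shows "tr (g X) = tr X"
proof -
  define \<tau> where "\<tau> X = tr (g X)" for X
  have add: "\<tau> (X + Y) = \<tau> X + \<tau> Y" if "X \<in> J1" "Y \<in> J1" for X Y
    using that by (simp add: \<tau>_def F4_add[OF g] tr_add)
  have scale: "\<tau> (c *\<^sub>R X) = c * \<tau> X" if "X \<in> J1" for c X
    using that by (simp add: \<tau>_def F4_scaleR[OF g] tr_scaleR)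
  have assoc: "\<tau> ((X \<circ>\<^sub>J Y) \<circ>\<^sub>J Z) = \<tau> (X \<circ>\<^sub>J (Y \<circ>\<^sub>J Z))" if "X \<in> J1" "Y \<in> J1" "Z \<in> J1" for X Y Z
    using that by (simp add: \<tau>_def F4_jordan[OF g] tr_jordan_assoc F4_J1[OF g])
  \<comment> \<open>\<open>F\<close> lies in the Peirce 1/2-space of the idempotent
    \<open>P\<close>, and the triple (\<open>P\<close>, \<open>P\<close>, \<open>F\<close>) gives
    \<tau> F / 2 = \<tau> F / 4.\<close>
  have off: "\<tau> F = 0" if "P \<in> J1" "F \<in> J1" "P \<circ>\<^sub>J P = P" "P \<circ>\<^sub>J F = (1/2) *\<^sub>R F"
    "P \<circ>\<^sub>J ((1/2) *\<^sub>R F) = (1/4) *\<^sub>R F" for P F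
    using assoc[OF that(1,1,2)] that by (simp add: scale)
  have F: "\<tau> (h1 0 0 0 x 0 0) = 0" "\<tau> (h1 0 0 0 0 x 0) = 0" "\<tau> (h1 0 0 0 0 0 x) = 0" for x
    by (rule off[of "E_diag 2"] off[of "E_diag 1"]; simp add: E_diag_h1 jordan_h1 h1_scaleR)+
  \<comment> \<open>With F an off-diagonal unit, the triple (\<open>E_diag 2\<close>, F, F) equates
    the values at \<open>E_diag 2\<close> and \<open>E_diag 3\<close>. The next one equates those at
    \<open>E_diag 1\<close> and \<open>E_diag 2\<close>; there the square of F is negative. The
    common value is 1 because \<open>g E = E\<close>.\<close>
  have "\<tau> ((1/2) *\<^sub>R (E_diag 2 + E_diag 3)) = \<tau> (E_diag 2)"
    using assoc[of "E_diag 2" "h1 0 0 0 oct_one 0 0" "h1 0 0 0 oct_one 0 0"]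
    by (simp add: E_diag_h1 jordan_h1 h1_scaleR h1_add flip: scaleR_2)
  moreover have "\<tau> ((-1/2) *\<^sub>R (E_diag 1 + E_diag 2)) = - \<tau> (E_diag 1)"
    using assoc[of "E_diag 1" "h1 0 0 0 0 0 oct_one" "h1 0 0 0 0 0 oct_one"] scale[of "E_diag 1" "-1"]
    by (simp add: E_diag_h1 jordan_h1 h1_scaleR h1_add flip: scaleR_2)
  moreover have "\<tau> (- X) = - \<tau> X" if "X \<in> J1" for X
    using scale[OF that, of "-1"] by simp
  moreover have "\<tau> (E_diag 1 + E_diag 2 + E_diag 3) = 3"
    by (simp add: E_diag_h1 h1_add \<tau>_def F4_E[OF g] E_h1[symmetric]) (simp add: E_h1 tr_h1)
  ultimately have diag: "\<tau> (E_diag 1) = 1" "\<tau> (E_diag 2) = 1" "\<tau> (E_diag 3) = 1"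
    by (simp_all add: add scale)
  obtain a1 a2 a3 x1 x2 x3 where "X = h1 a1 a2 a3 x1 x2 x3" using X by (rule J1_cases)
  then have X_eq: "X = a1 *\<^sub>R E_diag 1 + a2 *\<^sub>R E_diag 2 + a3 *\<^sub>R E_diag 3
      + h1 0 0 0 x1 0 0 + h1 0 0 0 0 x2 0 + h1 0 0 0 0 0 x3" and "tr X = a1 + a2 + a3"
    by (simp_all add: E_diag_h1 h1_add h1_scaleR tr_h1)
  then have "\<tau> X = tr X"
    unfolding X_eq by (simp add: add scale F diag)
  then show ?thesis by (simp add: \<tau>_def)
qed

lemma F4_jform: "g \<in> F4_m20 \<Longrightarrow> X \<in> J1 \<Longrightarrow> Y \<in> J1 \<Longrightarrow> jform (g X) (g Y) = jform X Y"
  by (simp add: jform_def F4_tr flip: F4_jordan)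

lemma F4_cross: "g \<in> F4_m20 \<Longrightarrow> X \<in> J1 \<Longrightarrow> Y \<in> J1 \<Longrightarrow> g (X \<times>\<^sub>J Y) = g X \<times>\<^sub>J g Y"
  by (simp add: cross_def F4_add F4_diff F4_scaleR F4_jordan F4_E F4_tr F4_jform)

lemma F4_jdet: "g \<in> F4_m20 \<Longrightarrow> X \<in> J1 \<Longrightarrow> jdet (g X) = jdet X"
  by (simp add: jdet_def F4_jform flip: F4_cross)

lemma F4_zero: "g \<in> F4_m20 \<Longrightarrow> g 0 = 0"
  using F4_scaleR[of g E 0] by simp

lemma F4_eq_zero_iff: "g \<in> F4_m20 \<Longrightarrow> X \<in> J1 \<Longrightarrow> g X = 0 \<longleftrightarrow> X = 0"
  by (metis F4_bij F4_zero E_in_J1 J1_scaleR bij_betw_imp_inj_on inj_onD scaleR_zero_left)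

section \<open>Group laws and the conjugacy relation\<close>

lemma F4_id: "restrict (\<lambda>X. X) J1 \<in> F4_m20"
  by (auto simp: F4_m20_def GL_J1_def bij_betw_def inj_on_def)

lemma F4_compose:
  assumes "g \<in> F4_m20" "h \<in> F4_m20"
  shows "compose J1 g h \<in> F4_m20"
  using assms F4_J1[OF assms(2)]
    bij_betw_trans[of h J1 J1 g J1, unfolded comp_def]
  by (simp add: F4_m20_def GL_J1_def compose_def cong: bij_betw_cong)

lemma F4_inv:
  assumes g: "g \<in> F4_m20"
  shows "restrict (inv_into J1 g) J1 \<in> F4_m20"
proof -
  let ?h = "inv_into J1 g"
  have bij: "bij_betw ?h J1 J1" using F4_bij[OF g] by (rule bij_betw_inv_into)
  have J: "?h X \<in> J1" if "X \<in> J1" for X using bij that by (rule bij_betw_apply)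
  have eq: "?h X = Y" if "Y \<in> J1" "g Y = X" for X Y
    using F4_bij[OF g] that by (metis bij_betw_inv_into_left)
  have g_h: "g (?h X) = X" if "X \<in> J1" for X
    using F4_bij[OF g] that by (rule bij_betw_inv_into_right)
  show ?thesis
    using bij by (simp add: F4_m20_def GL_J1_def eq J g_h F4_add[OF g] F4_scaleR[OF g] F4_jordan[OF g]
        cong: bij_betw_cong)
qed

text \<open>Membership in \<open>J1\<close> is built in because automorphisms are
  \<open>undefined\<close> elsewhere; this makes the relation an equivalence on
  \<open>J1\<close>.\<close>

definition sim :: "omat \<Rightarrow> omat \<Rightarrow> bool" (infix "\<sim>" 50) where
  "X \<sim> Y \<longleftrightarrow> X \<in> J1 \<and> Y \<in> J1 \<and> (\<exists>g\<in>F4_m20. g X = Y)"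

lemma sim_refl: "X \<in> J1 \<Longrightarrow> X \<sim> X"
  unfolding sim_def by (auto intro!: bexI[OF _ F4_id])

lemma sim_sym: "X \<sim> Y \<Longrightarrow> Y \<sim> X"
  unfolding sim_def by (auto intro!: bexI[OF _ F4_inv] simp: bij_betw_inv_into_left[OF F4_bij])

lemma sim_trans [trans]: "X \<sim> Y \<Longrightarrow> Y \<sim> Z \<Longrightarrow> X \<sim> Z"
  unfolding sim_def by (metis F4_compose compose_eq)

lemma Orb_F4: "v \<in> J1 \<Longrightarrow> Orb F4_m20 v = {X. v \<sim> X}"
  by (auto simp: Orb_def sim_def F4_J1)

text \<open>Polarisation reduces compatibility with the product to squares, and an involution is its
  own inverse, hence bijective.\<close>

lemma F4_involution:
  assumes J: "\<And>X. X \<in> J1 \<Longrightarrow> f X \<in> J1"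
    and add: "\<And>X Y. X \<in> J1 \<Longrightarrow> Y \<in> J1 \<Longrightarrow> f (X + Y) = f X + f Y"
    and scale: "\<And>c X. X \<in> J1 \<Longrightarrow> f (c *\<^sub>R X) = c *\<^sub>R f X"
    and inv: "\<And>X. X \<in> J1 \<Longrightarrow> f (f X) = X"
    and square: "\<And>X. X \<in> J1 \<Longrightarrow> f (X \<circ>\<^sub>J X) = f X \<circ>\<^sub>J f X"
  shows "restrict f J1 \<in> F4_m20"
proof -
  have "f (X \<circ>\<^sub>J Y) = f X \<circ>\<^sub>J f Y" if "X \<in> J1" "Y \<in> J1" for X Y
  proof -
    have sq: "(A + B) \<circ>\<^sub>J (A + B) = A \<circ>\<^sub>J A + B \<circ>\<^sub>J B + 2 *\<^sub>R (A \<circ>\<^sub>J B)" for A B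
      unfolding scaleR_2 by (simp add: jordan_add jordan_commute[of B A])
    have "f ((X + Y) \<circ>\<^sub>J (X + Y)) = (f X + f Y) \<circ>\<^sub>J (f X + f Y)"
      using that by (simp add: square add)
    then have "2 *\<^sub>R f (X \<circ>\<^sub>J Y) = 2 *\<^sub>R (f X \<circ>\<^sub>J f Y)"
      using that unfolding sq by (simp add: add square scale)
    then show ?thesis by simp
  qed
  moreover have "bij_betw f J1 J1"
    by (rule bij_betw_byWitness[of J1 f]) (auto simp: inv J)
  ultimately show ?thesis
    by (simp add: F4_m20_def GL_J1_def add scale cong: bij_betw_cong)
qed

section \<open>Explicit automorphisms\<close>

text \<open>Turns a formula in coordinates into a function on matrices; the choice is unambiguous
  since \<open>h1\<close> is injective.\<close>

lemma h1_lift: "\<exists>f. \<forall>a1 a2 a3 x1 x2 x3. f (h1 a1 a2 a3 x1 x2 x3) = \<phi> a1 a2 a3 x1 x2 x3"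
  by (rule exI[of _ "\<lambda>X. SOME Y. \<exists>a1 a2 a3 x1 x2 x3. X = h1 a1 a2 a3 x1 x2 x3 \<and> Y = \<phi> a1 a2 a3 x1 x2 x3"])
    simp

text \<open>The automorphism criterion in coordinates. Since \<open>\<phi>\<close> returns a matrix,
  \<open>inv\<close> has to name the coordinates of the image before applying \<open>\<phi>\<close>
  again; \<open>square\<close> has the coordinates of the Jordan square filled in.\<close>

lemma sim_involution:
  assumes J: "\<And>a1 a2 a3 x1 x2 x3. \<phi> a1 a2 a3 x1 x2 x3 \<in> J1"
    and add: "\<And>a1 a2 a3 x1 x2 x3 b1 b2 b3 y1 y2 y3.
      \<phi> (a1 + b1) (a2 + b2) (a3 + b3) (x1 + y1) (x2 + y2) (x3 + y3) = \<phi> a1 a2 a3 x1 x2 x3 + \<phi> b1 b2 b3 y1 y2 y3"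
    and scale: "\<And>c a1 a2 a3 x1 x2 x3. \<phi> (c * a1) (c * a2) (c * a3) (c *\<^sub>R x1) (c *\<^sub>R x2) (c *\<^sub>R x3) = c *\<^sub>R \<phi> a1 a2 a3 x1 x2 x3"
    and inv: "\<And>a1 a2 a3 x1 x2 x3 b1 b2 b3 y1 y2 y3. \<phi> a1 a2 a3 x1 x2 x3 = h1 b1 b2 b3 y1 y2 y3 \<Longrightarrow>
      \<phi> b1 b2 b3 y1 y2 y3 = h1 a1 a2 a3 x1 x2 x3"
    and square: "\<And>a1 a2 a3 x1 x2 x3.
      \<phi> (a1 * a1 - x2 \<bullet> x2 - x3 \<bullet> x3) (a2 * a2 + x1 \<bullet> x1 - x3 \<bullet> x3) (a3 * a3 + x1 \<bullet> x1 - x2 \<bullet> x2)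
        ((a2 + a3) *\<^sub>R x1 - oct_cnj (x2 \<star> x3)) ((a3 + a1) *\<^sub>R x2 + oct_cnj (x3 \<star> x1))
        ((a1 + a2) *\<^sub>R x3 + oct_cnj (x1 \<star> x2))
      = \<phi> a1 a2 a3 x1 x2 x3 \<circ>\<^sub>J \<phi> a1 a2 a3 x1 x2 x3"
  shows "h1 a1 a2 a3 x1 x2 x3 \<sim> \<phi> a1 a2 a3 x1 x2 x3"
proof -
  obtain f where f: "f (h1 a1 a2 a3 x1 x2 x3) = \<phi> a1 a2 a3 x1 x2 x3" for a1 a2 a3 x1 x2 x3
    using h1_lift[of \<phi>] by blast
  have "f (f X) = X" if "X \<in> J1" for X
    using that by (elim J1_cases) (metis J J1_cases f inv)
  then have "restrict f J1 \<in> F4_m20"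
    by (intro F4_involution) (auto elim!: J1_cases simp: h1_add h1_scaleR jordan_self_h1 f J add scale square)
  then show ?thesis
    by (auto simp: sim_def J f intro!: bexI[of _ "restrict f J1"])
qed

text \<open>
  Conjugation by the matrix with first row \<open>(1, 0, 0)\<close> and lower right block
  \<open>((t, u), (cnj u, -t))\<close>.
\<close>

lemma sim_block23:
  assumes tu: "t * t + u \<bullet> u = 1"
  shows "h1 a1 a2 a3 x1 x2 x3 \<sim>
    h1 a1 (a3 + 2 * t * (t * (a2 - a3) / 2 + u \<bullet> x1)) (a2 - 2 * t * (t * (a2 - a3) / 2 + u \<bullet> x1))
      ((2 * (t * (a2 - a3) / 2 + u \<bullet> x1)) *\<^sub>R u - x1)
      (oct_cnj (x3 \<star> u) - t *\<^sub>R x2) (t *\<^sub>R x3 + oct_cnj (u \<star> x2))"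
proof (rule sim_involution[where \<phi> = "\<lambda>a1 a2 a3 x1 x2 x3.
    h1 a1 (a3 + 2 * t * (t * (a2 - a3) / 2 + u \<bullet> x1)) (a2 - 2 * t * (t * (a2 - a3) / 2 + u \<bullet> x1))
      ((2 * (t * (a2 - a3) / 2 + u \<bullet> x1)) *\<^sub>R u - x1)
      (oct_cnj (x3 \<star> u) - t *\<^sub>R x2) (t *\<^sub>R x3 + oct_cnj (u \<star> x2))"], goal_cases)
  case 1
  show ?case by simp
next
  case 2
  show ?case
    by (simp add: h1_add inner_add_right oct_mult_add field_simps) (simp add: vec_eq_iff field_simps)
next
  case 3
  show ?case
    by (simp add: h1_scaleR oct_mult_scaleR field_simps)
next
  case (4 a1 a2 a3 x1 x2 x3 b1 b2 b3 y1 y2 y3)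
  \<comment> \<open>With H the traceless block ((t, u), (cnj u, -t)), \<open>c\<close> is half of (H
    | X), and conjugation by H sends the traceless part Y of the 2x2 block to 2 c H - Y, a
    reflection that fixes H.\<close>
  define c where "c = t * (a2 - a3) / 2 + u \<bullet> x1"
  have b: "b1 = a1" "b2 = a3 + 2 * t * c" "b3 = a2 - 2 * t * c" "y1 = (2 * c) *\<^sub>R u - x1"
    "y2 = oct_cnj (x3 \<star> u) - t *\<^sub>R x2" "y3 = t *\<^sub>R x3 + oct_cnj (u \<star> x2)"
    using 4 by (simp_all add: c_def)
  have uu: "u \<bullet> u = 1 - t * t" using tu by simp
  have c': "t * (b2 - b3) / 2 + u \<bullet> y1 = c"
    by (simp add: b inner_diff_right uu) (simp add: c_def field_simps)
  have 2: "oct_cnj (y3 \<star> u) - t *\<^sub>R y2 = x2"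
    by (simp add: b oct_mult_add oct_mult_scaleR oct_cnj_mult oct_cnj_mult_self_left uu algebra_simps)
  have 3: "t *\<^sub>R y3 + oct_cnj (u \<star> y2) = x3"
    by (simp add: b oct_mult_diff oct_mult_scaleR oct_cnj_mult oct_cnj_mult_self_right uu algebra_simps)
  show ?case
    unfolding c' 2 3 by (simp add: b)
next
  case (5 a1 a2 a3 x1 x2 x3)
  define c where "c = t * (a2 - a3) / 2 + u \<bullet> x1"
  \<comment> \<open>\<open>p\<close> and \<open>q\<close> are the parts of the new \<open>x2\<close>
    and \<open>x3\<close> that contain \<open>u\<close>; \<open>z\<close>, \<open>v\<close>,
    \<open>w\<close> are the octonion products in the square of the given element. Pairing
    \<open>p\<close> with \<open>x2\<close> or \<open>q\<close> with \<open>x3\<close> gives the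
    triple product \<open>T\<close>.\<close>
  define T where "T = u \<bullet> oct_cnj (x2 \<star> x3)"
  define p q where "p = oct_cnj (x3 \<star> u)" and "q = oct_cnj (u \<star> x2)"
  define z v w where "z = oct_cnj (x2 \<star> x3)" and "v = oct_cnj (x3 \<star> x1)" and "w = oct_cnj (x1 \<star> x2)"
  have uu: "u \<bullet> u = 1 - t * t" using tu by simp
  have e: "u \<bullet> x1 = c - t * (a2 - a3) / 2" by (simp add: c_def)
  have p_x2: "p \<bullet> x2 = T" "x2 \<bullet> p = T"
    unfolding p_def T_def by (metis inner_cnj_mult_cycle inner_commute)+
  have q_x3: "q \<bullet> x3 = T" "x3 \<bullet> q = T"
    unfolding q_def T_def by (metis inner_cnj_mult_cycle inner_commute)+
  have pp: "p \<bullet> p = (x3 \<bullet> x3) * (1 - t * t)" and qq: "q \<bullet> q = (x2 \<bullet> x2) * (1 - t * t)"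
    by (simp_all add: p_def q_def inner_oct_mult_self_left inner_oct_mult_self_right uu)
  have x23': "oct_cnj ((p - t *\<^sub>R x2) \<star> (t *\<^sub>R x3 + q))
      = (t * (x3 \<bullet> x3) - t * (x2 \<bullet> x2) + 2 * T) *\<^sub>R u - z"
  proof -
    have "p \<star> x3 = (x3 \<bullet> x3) *\<^sub>R oct_cnj u" "x2 \<star> q = (x2 \<bullet> x2) *\<^sub>R oct_cnj u"
      by (simp_all add: p_def q_def oct_cnj_mult oct_mult_cnj_self_right oct_mult_cnj_self_left)
    \<comment> \<open>This product has the shape (a x)(y a) with \<open>a = oct_cnj u\<close>, so
      the middle Moufang identity evaluates it.\<close>
    moreover have "p \<star> q = (2 * T) *\<^sub>R oct_cnj u - (1 - t * t) *\<^sub>R (x2 \<star> x3)"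
      using oct_moufang[of "oct_cnj u" "oct_cnj x3" "oct_cnj x2"]
      by (simp add: p_def q_def oct_cnj_mult[of _ u] oct_cnj_mult[of u] T_def uu inner_cnj_swap)
        (simp add: oct_cnj_mult)
    ultimately show ?thesis
      unfolding z_def by (simp add: oct_mult_add oct_mult_diff oct_mult_scaleR) (simp add: algebra_simps)
  qed
  have x31': "oct_cnj ((t *\<^sub>R x3 + q) \<star> ((2 * c) *\<^sub>R u - x1))
      = (2 * c * t) *\<^sub>R p - t *\<^sub>R v + (2 * c * (1 - t * t) - 2 * (u \<bullet> x1)) *\<^sub>R x2 + oct_cnj (w \<star> u)"
  proof -
    have "q \<star> u = (1 - t * t) *\<^sub>R oct_cnj x2"
      by (simp add: q_def oct_cnj_mult oct_mult_cnj_self_right uu)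
    moreover have "q \<star> x1 = (2 * (u \<bullet> x1)) *\<^sub>R oct_cnj x2 - w \<star> u"
      using oct_mult_cnj_polar[of "oct_cnj x2" "oct_cnj u" "oct_cnj x1"]
      by (simp add: q_def w_def oct_cnj_mult eq_diff_eq)
    ultimately show ?thesis
      unfolding p_def v_def by (simp add: oct_mult_add oct_mult_diff oct_mult_scaleR) (simp add: algebra_simps)
  qed
  have x12': "oct_cnj (((2 * c) *\<^sub>R u - x1) \<star> (p - t *\<^sub>R x2))
      = (2 * c * (1 - t * t) - 2 * (u \<bullet> x1)) *\<^sub>R x3 - (2 * c * t) *\<^sub>R q + t *\<^sub>R w + oct_cnj (u \<star> v)"
  proof -
    have "u \<star> p = (1 - t * t) *\<^sub>R oct_cnj x3"
      by (simp add: p_def oct_cnj_mult oct_mult_cnj_self_left uu)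
    moreover have "x1 \<star> p = (2 * (u \<bullet> x1)) *\<^sub>R oct_cnj x3 - u \<star> v"
      using oct_mult_cnj_polar_left[of x1 u "oct_cnj x3"]
      by (simp add: p_def v_def oct_cnj_mult eq_diff_eq inner_commute)
    ultimately show ?thesis
      unfolding q_def w_def by (simp add: oct_mult_add oct_mult_diff oct_mult_scaleR) (simp add: algebra_simps)
  qed
  have c': "t * ((a2 * a2 + x1 \<bullet> x1 - x3 \<bullet> x3) - (a3 * a3 + x1 \<bullet> x1 - x2 \<bullet> x2)) / 2
      + u \<bullet> ((a2 + a3) *\<^sub>R x1 - z) = (a2 + a3) * c + t * (x2 \<bullet> x2 - x3 \<bullet> x3) / 2 - T"
    by (simp add: inner_diff_right e T_def z_def) (simp add: field_simps)
  have lin: "oct_cnj (((a1 + a2) *\<^sub>R x3 + w) \<star> u) = (a1 + a2) *\<^sub>R p + oct_cnj (w \<star> u)"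
    "oct_cnj (u \<star> ((a3 + a1) *\<^sub>R x2 + v)) = (a3 + a1) *\<^sub>R q + oct_cnj (u \<star> v)"
    by (simp_all add: oct_mult_add oct_mult_scaleR p_def q_def)
  show ?case
    unfolding jordan_self_h1 c_def[symmetric] p_def[symmetric] q_def[symmetric] z_def[symmetric]
      v_def[symmetric] w_def[symmetric] c' x23' x31' x12' lin
    unfolding h1_eq_iff
    apply (intro conjI)
    subgoal by (simp add: inner_simps p_x2 q_x3 pp qq algebra_simps)
    subgoal by (simp add: inner_simps inner_commute[of x1 u] p_x2 q_x3 pp qq uu e field_simps)
    subgoal by (simp add: inner_simps inner_commute[of x1 u] p_x2 q_x3 pp qq uu e field_simps)
    subgoal by (simp add: vec_eq_iff field_simps)
    subgoal by (simp add: vec_eq_iff e field_simps)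
    subgoal by (simp add: vec_eq_iff e field_simps)
    done
qed

text \<open>
  Conjugation by the matrix with upper left block \<open>((t, i r), (i r, -t))\<close> and last row \<open>(0, 0, 1)\<close>.
\<close>

lemma sim_block12:
  assumes tr: "t * t - r * r = 1"
  shows "h1 a1 a2 a3 x1 x2 x3 \<sim>
    h1 (a2 + 2 * t * (t * (a1 - a2) / 2 - r * (x3 \<bullet> oct_one))) (a1 - 2 * t * (t * (a1 - a2) / 2 - r * (x3 \<bullet> oct_one))) a3
      (- (t *\<^sub>R x1) - r *\<^sub>R oct_cnj x2) (t *\<^sub>R x2 + r *\<^sub>R oct_cnj x1)
      ((2 * r * (t * (a1 - a2) / 2 - r * (x3 \<bullet> oct_one))) *\<^sub>R oct_one - x3)"
proof (rule sim_involution[where \<phi> = "\<lambda>a1 a2 a3 x1 x2 x3.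
    h1 (a2 + 2 * t * (t * (a1 - a2) / 2 - r * (x3 \<bullet> oct_one))) (a1 - 2 * t * (t * (a1 - a2) / 2 - r * (x3 \<bullet> oct_one))) a3
      (- (t *\<^sub>R x1) - r *\<^sub>R oct_cnj x2) (t *\<^sub>R x2 + r *\<^sub>R oct_cnj x1)
      ((2 * r * (t * (a1 - a2) / 2 - r * (x3 \<bullet> oct_one))) *\<^sub>R oct_one - x3)"], goal_cases)
  case 1
  show ?case by simp
next
  case 2
  show ?case
    by (simp add: h1_add inner_add_left oct_mult_add field_simps) (simp add: vec_eq_iff field_simps)
next
  case 3
  show ?case
    by (simp add: h1_scaleR oct_mult_scaleR field_simps)
next
  case (4 a1 a2 a3 x1 x2 x3 b1 b2 b3 y1 y2 y3)
  \<comment> \<open>Again half of (H | X), now for H = ((t, i r), (i r, -t)); the minus sign comes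
    from the square of i.\<close>
  define c where "c = t * (a1 - a2) / 2 - r * (x3 \<bullet> oct_one)"
  have b: "b1 = a2 + 2 * t * c" "b2 = a1 - 2 * t * c" "b3 = a3" "y1 = - (t *\<^sub>R x1) - r *\<^sub>R oct_cnj x2"
    "y2 = t *\<^sub>R x2 + r *\<^sub>R oct_cnj x1" "y3 = (2 * r * c) *\<^sub>R oct_one - x3"
    using 4 by (simp_all add: c_def)
  have tt: "t * t = 1 + r * r" using tr by simp
  have "t * (b1 - b2) / 2 - r * (y3 \<bullet> oct_one) = 2 * c * (t * t - r * r) - c"
    by (simp add: b inner_diff_left) (simp add: c_def field_simps)
  then have c': "t * (b1 - b2) / 2 - r * (y3 \<bullet> oct_one) = c"
    by (simp add: tr)
  show ?case
    unfolding c' by (simp add: b algebra_simps tt)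
next
  case (5 a1 a2 a3 x1 x2 x3)
  define c where "c = t * (a1 - a2) / 2 - r * (x3 \<bullet> oct_one)"
  define e where "e = x3 \<bullet> oct_one"
  define T where "T = oct_cnj (x1 \<star> x2) \<bullet> oct_one"
  define z v w where "z = oct_cnj (x2 \<star> x3)" and "v = oct_cnj (x3 \<star> x1)" and "w = oct_cnj (x1 \<star> x2)"
  have tt: "t * t = 1 + r * r" using tr by simp
  \<comment> \<open>\<open>tt'\<close>, \<open>re'\<close> and \<open>cre\<close> restate
    \<open>tt\<close> and \<open>re\<close> in the shapes that occur inside longer products.\<close>
  have tt': "t * (t * s) = s + r * (r * s)" for s
    using tt by (metis distrib_right mult.assoc mult_1)
  have re: "r * e = t * (a1 - a2) / 2 - c" by (simp add: c_def e_def)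
  have re': "e * (r * s) = (t * (a1 - a2) / 2 - c) * s" for s
    using re by (metis mult.assoc mult.commute)
  have cre: "c * (r * e) = c * (t * (a1 - a2) / 2 - c)" by (simp add: re)
  have x1_x2: "x1 \<bullet> oct_cnj x2 = T" "oct_cnj x2 \<bullet> x1 = T" "x2 \<bullet> oct_cnj x1 = T" "oct_cnj x1 \<bullet> x2 = T"
    unfolding T_def by (metis inner_cnj_mult_cycle inner_commute inner_cnj_swap oct_mult_one)+
  \<comment> \<open>Since \<open>r\<close> is real, the conjugates that arise can be traded for
    twice a real part.\<close>
  have w_cnj: "oct_cnj w = (2 * T) *\<^sub>R oct_one - w"
    using oct_add_cnj[of w] by (simp add: eq_diff_eq w_def T_def add.commute)
  have x3_cnj: "oct_cnj x3 = (2 * e) *\<^sub>R oct_one - x3"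
    using oct_add_cnj[of x3] by (simp add: eq_diff_eq e_def add.commute)
  have x23': "oct_cnj ((t *\<^sub>R x2 + r *\<^sub>R oct_cnj x1) \<star> ((2 * r * c) *\<^sub>R oct_one - x3))
      = (2 * r * c * t) *\<^sub>R oct_cnj x2 + (2 * r * c * r - 2 * (r * e)) *\<^sub>R x1 - t *\<^sub>R z + r *\<^sub>R oct_cnj v"
    by (simp add: oct_mult_add oct_mult_diff oct_mult_scaleR z_def v_def oct_cnj_mult)
      (simp add: x3_cnj oct_mult_diff oct_mult_scaleR algebra_simps)
  have x31': "oct_cnj (((2 * r * c) *\<^sub>R oct_one - x3) \<star> (- (t *\<^sub>R x1) - r *\<^sub>R oct_cnj x2))
      = t *\<^sub>R v - (2 * r * c * t) *\<^sub>R oct_cnj x1 + (2 * (r * e) - 2 * r * c * r) *\<^sub>R x2 - r *\<^sub>R oct_cnj z"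
    by (simp add: oct_mult_add oct_mult_diff oct_mult_scaleR z_def v_def oct_cnj_mult)
      (simp add: x3_cnj oct_mult_diff oct_mult_scaleR algebra_simps)
  have x12': "oct_cnj ((- (t *\<^sub>R x1) - r *\<^sub>R oct_cnj x2) \<star> (t *\<^sub>R x2 + r *\<^sub>R oct_cnj x1))
      = - w - (t * r * (x1 \<bullet> x1 + x2 \<bullet> x2) + 2 * r * r * T) *\<^sub>R oct_one"
  proof -
    have "oct_cnj ((- (t *\<^sub>R x1) - r *\<^sub>R oct_cnj x2) \<star> (t *\<^sub>R x2 + r *\<^sub>R oct_cnj x1))
        = - ((t * t) *\<^sub>R w) - (r * r) *\<^sub>R oct_cnj w - (t * r * (x1 \<bullet> x1 + x2 \<bullet> x2)) *\<^sub>R oct_one"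
      by (simp add: oct_mult_add oct_mult_diff oct_mult_scaleR w_def oct_mult_cnj oct_cnj_mult_self
          algebra_simps) (simp add: oct_cnj_mult)
    then show ?thesis
      by (simp add: w_cnj tt algebra_simps)
  qed
  have c': "t * ((a1 * a1 - x2 \<bullet> x2 - x3 \<bullet> x3) - (a2 * a2 + x1 \<bullet> x1 - x3 \<bullet> x3)) / 2
      - r * (((a1 + a2) *\<^sub>R x3 + w) \<bullet> oct_one) = (a1 + a2) * c - t * (x1 \<bullet> x1 + x2 \<bullet> x2) / 2 - r * T"
    by (simp add: inner_add_left c_def T_def w_def) (simp add: field_simps)
  have cnj: "oct_cnj ((a3 + a1) *\<^sub>R x2 + v) = (a3 + a1) *\<^sub>R oct_cnj x2 + oct_cnj v"
    "oct_cnj ((a2 + a3) *\<^sub>R x1 - z) = (a2 + a3) *\<^sub>R oct_cnj x1 - oct_cnj z"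
    by simp_all
  have X1: "(- (t *\<^sub>R x1) - r *\<^sub>R oct_cnj x2) \<bullet> (- (t *\<^sub>R x1) - r *\<^sub>R oct_cnj x2)
      = t * t * (x1 \<bullet> x1) + 2 * t * r * T + r * r * (x2 \<bullet> x2)"
    by (simp add: inner_simps x1_x2 algebra_simps)
  have X2: "(t *\<^sub>R x2 + r *\<^sub>R oct_cnj x1) \<bullet> (t *\<^sub>R x2 + r *\<^sub>R oct_cnj x1)
      = t * t * (x2 \<bullet> x2) + 2 * t * r * T + r * r * (x1 \<bullet> x1)"
    by (simp add: inner_simps x1_x2 algebra_simps)
  have X3: "((2 * r * c) *\<^sub>R oct_one - x3) \<bullet> ((2 * r * c) *\<^sub>R oct_one - x3)
      = 4 * r * r * c * c - 4 * c * (r * e) + x3 \<bullet> x3"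
    by (simp add: inner_simps e_def inner_commute[of oct_one x3] algebra_simps)
  show ?case
    unfolding jordan_self_h1 c_def[symmetric] z_def[symmetric]
      v_def[symmetric] w_def[symmetric] c' x23' x31' x12' cnj X1 X2 X3
    unfolding h1_eq_iff
    apply (intro conjI)
    subgoal using cre by (simp add: field_simps tt tt')
    subgoal using cre by (simp add: field_simps tt tt')
    subgoal using cre by (simp add: field_simps tt tt')
    subgoal by (simp add: re re' tt tt' vec_eq_iff field_simps)
    subgoal by (simp add: re re' tt tt' vec_eq_iff field_simps)
    subgoal by (simp add: re re' tt tt' vec_eq_iff field_simps)
    done
qed

section \<open>Invariants along orbits and first normal forms\<close>

lemma sim_J1: "X \<sim> Y \<Longrightarrow> X \<in> J1" "X \<sim> Y \<Longrightarrow> Y \<in> J1"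
  by (simp_all add: sim_def)

lemma sim_tr: "X \<sim> Y \<Longrightarrow> tr Y = tr X"
  by (auto simp: sim_def F4_tr)

lemma sim_jdet: "X \<sim> Y \<Longrightarrow> jdet Y = jdet X"
  by (auto simp: sim_def F4_jdet)

lemma sim_cross: "X \<sim> Y \<Longrightarrow> X \<times>\<^sub>J X \<sim> Y \<times>\<^sub>J Y"
  by (auto simp: sim_def F4_cross)

lemma sim_eq_zero_iff: "X \<sim> Y \<Longrightarrow> Y = 0 \<longleftrightarrow> X = 0"
  by (auto simp: sim_def F4_zero) (metis F4_eq_zero_iff)

lemma sim_cross_eq_zero_iff: "X \<sim> Y \<Longrightarrow> Y \<times>\<^sub>J Y = 0 \<longleftrightarrow> X \<times>\<^sub>J X = 0"
  using sim_cross sim_eq_zero_iff by blast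

lemma sim_swap23: "h1 a1 a2 a3 0 x2 x3 \<sim> h1 a1 a3 a2 0 (oct_cnj x3) (oct_cnj x2)"
  using sim_block23[of 0 oct_one a1 a2 a3 0 x2 x3] by simp

text \<open>Diagonalisation of the lower right Hermitian block. Its traceless part (d, x1) has
  length m in the Euclidean space R x O; the reflection fixing the normalised bisector (t, u) = (d +
  m, x1) / K sends it to (m, 0).\<close>

lemma sim_x1_zero: "\<exists>b2 b3 y2 y3. h1 a1 a2 a3 x1 x2 x3 \<sim> h1 a1 b2 b3 0 y2 y3"
proof -
  define d where "d = (a2 - a3) / 2"
  define m where "m = sqrt (d * d + x1 \<bullet> x1)"
  have mm: "m * m = d * d + x1 \<bullet> x1"
    by (simp add: m_def)
  have m: "m \<ge> \<bar>d\<bar>"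
    by (simp add: m_def real_le_rsqrt power2_eq_square)
  show ?thesis
  \<comment> \<open>The bisector vanishes when \<open>x1 = 0\<close> and d \<le> 0, so this case is
    treated separately.\<close>
  proof (cases "x1 = 0")
    case True
    then show ?thesis using sim_refl[OF h1_in_J1] by blast
  next
    case False
    then have "m * m > d * d"
      by (simp add: mm)
    then have pos: "m + d > 0"
      using m by (cases "m + d = 0") (auto simp: eq_neg_iff_add_eq_0[symmetric])
    then have "m > 0" using m by linarith
    define K where "K = sqrt (2 * m * (m + d))"
    have K: "K * K = 2 * m * (m + d)" "K \<noteq> 0"
      using pos \<open>m > 0\<close> by (simp_all add: K_def)
    define t u where "t = (d + m) / K" and "u = (1 / K) *\<^sub>R x1"
    have tu: "t * t + u \<bullet> u = 1"
    proof -
      have "t * t + u \<bullet> u = ((d + m) * (d + m) + x1 \<bullet> x1) / (K * K)"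
        by (simp add: t_def u_def) (simp add: add_divide_distrib)
      also have "(d + m) * (d + m) + x1 \<bullet> x1 = K * K"
        unfolding K using mm by (simp add: algebra_simps)
      finally show ?thesis using K(2) by simp
    qed
    have c: "t * d + u \<bullet> x1 = K / 2"
    proof -
      have "t * d + u \<bullet> x1 = ((d + m) * d + x1 \<bullet> x1) / K"
        by (simp add: t_def u_def) (simp add: add_divide_distrib)
      also have "(d + m) * d + x1 \<bullet> x1 = K * K / 2"
        unfolding K using mm by (simp add: algebra_simps)
      finally show ?thesis using K(2) by simp
    qed
    have e: "t * (a2 - a3) / 2 + u \<bullet> x1 = K / 2"
      using c by (simp add: d_def)
    have "(2 * (t * (a2 - a3) / 2 + u \<bullet> x1)) *\<^sub>R u - x1 = 0"
      unfolding e using K(2) by (simp add: u_def)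
    then show ?thesis
      using sim_block23[OF tu, of a1 a2 a3 x1 x2 x3] by auto
  qed
qed

text \<open>With \<open>x1 = 0\<close> the equation \<open>X \<times> X = 0\<close> forces \<open>\<xi>2 \<xi>3 = 0\<close>, and \<open>\<xi>3 = 0\<close> forces \<open>x2 = 0\<close>.\<close>

lemma sim_null_reduce:
  assumes "h1 a1 a2 a3 x1 x2 x3 \<times>\<^sub>J h1 a1 a2 a3 x1 x2 x3 = 0"
  obtains b y where "h1 a1 a2 a3 x1 x2 x3 \<sim> h1 a1 b 0 0 0 y" "a1 * b + y \<bullet> y = 0" "a1 + b = a1 + a2 + a3"
proof -
  obtain b2 b3 y2 y3 where s: "h1 a1 a2 a3 x1 x2 x3 \<sim> h1 a1 b2 b3 0 y2 y3"
    using sim_x1_zero by blast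
  have 0: "b2 * b3 = 0" "b3 * a1 + y2 \<bullet> y2 = 0" "a1 * b2 + y3 \<bullet> y3 = 0"
    using sim_cross_eq_zero_iff[OF s] assms by (simp_all add: cross_self_h1 flip: h1_zero)
  have tr: "b2 + b3 = a2 + a3"
    using sim_tr[OF s] by (simp add: tr_h1)
  from 0(1) consider "b3 = 0" | "b2 = 0" by auto
  then show thesis
  proof cases
    case 1
    then show thesis using 0 tr s by (intro that[of b2 y3]) simp_all
  next
    case 2
    then show thesis using 0 tr sim_trans[OF s sim_swap23]
      by (intro that[of b3 "oct_cnj y2"]) (simp_all add: mult.commute)
  qed
qed

text \<open>Two involutions with \<open>t = 0\<close> compose to right multiplication of the third
  entry by a unit octonion. Both signs of \<open>s\<close> are allowed, so that the sign can be
  fitted to a boost.\<close>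

lemma sim_x3_real:
  assumes s: "s * s = x \<bullet> x"
  shows "h1 a b 0 0 0 x \<sim> h1 a b 0 0 0 (s *\<^sub>R oct_one)"
proof (cases "s = 0")
  case True
  then show ?thesis using s by (simp add: sim_refl)
next
  case False
  define u where "u = (1 / s) *\<^sub>R x"
  have u: "u \<bullet> u = 1"
    using False by (simp add: u_def flip: s)
  have "h1 a b 0 0 0 x \<sim> h1 a 0 b 0 (oct_cnj x) 0"
    using sim_swap23[of a b 0 0 x] by simp
  also have "h1 a 0 b 0 (oct_cnj x) 0 \<sim> h1 a b 0 0 0 (x \<star> oct_cnj u)"
    using sim_block23[of 0 u a 0 b 0 "oct_cnj x" 0] by (simp add: u oct_cnj_mult)
  also have "x \<star> oct_cnj u = s *\<^sub>R oct_one"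
    using False by (simp add: u_def oct_mult_scaleR oct_mult_cnj flip: s)
  finally show ?thesis .
qed

text \<open>In the light cone coordinates \<open>d + s\<close> and \<open>d - s\<close>, where \<open>d = (a - b) / 2\<close>.\<close>

lemma sim_boost:
  assumes "\<kappa> > 0" and sum: "a' + b' = a + b"
    and plus: "(a' - b') / 2 + s' = \<kappa> * ((a - b) / 2 - s)"
    and minus: "\<kappa> * ((a' - b') / 2 - s') = (a - b) / 2 + s"
  shows "h1 a b 0 0 0 (s *\<^sub>R oct_one) \<sim> h1 a' b' 0 0 0 (s' *\<^sub>R oct_one)"
proof -
  define l k where "l = sqrt \<kappa>" and "k = 1 / l"
  have l: "l * l = \<kappa>" "l * k = 1"
    using assms(1) by (simp_all add: l_def k_def)
  \<comment> \<open>\<open>t\<close> and \<open>r\<close> are cosh and sinh of log l. The involution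
    interchanges the two null directions and scales them by \<kappa> and its inverse.\<close>
  define t r where "t = (l + k) / 2" and "r = (l - k) / 2"
  define c where "c = t * (a - b) / 2 - r * s"
  have tr: "t * t - r * r = 1"
    using l(2) by (simp add: t_def r_def field_simps)
  define q q' where "q = (a - b) / 2 - s" and "q' = (a' - b') / 2 - s'"
  have p: "(a - b) / 2 + s = l * l * q'" and p': "(a' - b') / 2 + s' = l * l * q"
    using plus minus by (simp_all add: q_def q'_def l(1))
  have "2 * c = l * ((a - b) / 2 - s) + k * ((a - b) / 2 + s)"
    by (simp add: c_def t_def r_def field_simps)
  then have "2 * c = l * q + (l * k) * l * q'"
    unfolding p by (simp add: q_def algebra_simps)
  then have c: "2 * c = l * (q + q')"
    using l(2) by (simp add: algebra_simps)
  have "2 * t * c = t * (2 * c)" "2 * r * c = r * (2 * c)"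
    by simp_all
  then have tc: "2 * t * c = (l * l + l * k) * (q + q') / 2"
    and rc: "2 * r * c = (l * l - l * k) * (q + q') / 2"
    unfolding c by (simp_all add: t_def r_def field_simps)
  have ab: "a - b = l * l * q' + q" "2 * s = l * l * q' - q" "a' - b' = l * l * q + q'" "2 * s' = l * l * q - q'"
    by (simp_all only: p[symmetric] p'[symmetric]) (simp_all add: q_def q'_def field_simps)
  have "b + 2 * t * c = a'" "a - 2 * t * c = b'" "2 * r * c - s = s'"
    using ab sum unfolding tc rc l(2) by (simp_all add: field_simps)
  then show ?thesis
    using sim_block12[OF tr, of a b 0 0 0 "s *\<^sub>R oct_one"]
    by (simp add: c_def flip: scaleR_diff_left)
qed

section \<open>Null elements\<close>

lemma jform_E1: "jform (h1 a1 a2 a3 x1 x2 x3) (E_diag 1) = a1"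
  by (simp add: E_diag_h1 jform_h1)

text \<open>The remaining equation reads |y|^2 = a1 (a1 - 1), which excludes 0 < a1 < 1; the two
  ranges left give the two normal forms.\<close>

lemma null_tr_one:
  assumes "X \<in> J1" "X \<times>\<^sub>J X = 0" "tr X = 1"
  obtains "jform X (E_diag 1) \<ge> 1" "X \<sim> E_diag 1" | "jform X (E_diag 1) \<le> 0" "X \<sim> E_diag 2"
proof -
  obtain a1 a2 a3 x1 x2 x3 where X: "X = h1 a1 a2 a3 x1 x2 x3" using assms(1) by (rule J1_cases)
  obtain b y where s: "X \<sim> h1 a1 b 0 0 0 y" and y: "a1 * b + y \<bullet> y = 0" and "a1 + b = a1 + a2 + a3"
    using sim_null_reduce[OF assms(2)[unfolded X]] unfolding X by blast
  then have b: "b = 1 - a1"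
    using assms(3) by (simp add: X tr_h1)
  have jf: "jform X (E_diag 1) = a1"
    by (simp only: X jform_E1)
  have yy: "y \<bullet> y = a1 * (a1 - 1)"
    using y by (simp add: b algebra_simps)
  then have "a1 * (a1 - 1) \<ge> 0"
    by (metis inner_ge_zero)
  then consider "a1 \<ge> 1" | "a1 \<le> 0"
    by (auto simp: zero_le_mult_iff)
  then show thesis
  proof cases
    case 1
    have "X \<sim> h1 a1 b 0 0 0 (norm y *\<^sub>R oct_one)"
      using s sim_x3_real[of "norm y" y a1 b] by (auto simp: dot_square_norm power2_eq_square intro: sim_trans)
    also have "\<dots> \<sim> h1 1 0 0 0 0 (0 *\<^sub>R oct_one)"
    \<comment> \<open>With d = a1 - 1/2 and s = |y| one has d^2 - s^2 = 1/4, so the required factor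
      (1/2) / (d - s) equals 2 (d + s), clearly positive. In the other case the sign of s is
      reversed for the same reason.\<close>
    proof (rule sim_boost[where \<kappa> = "2 * a1 - 1 + 2 * norm y"])
      have "norm y * norm y = a1 * (a1 - 1)"
        by (metis yy dot_square_norm power2_eq_square)
      then show "(1 - 0) / 2 + 0 = (2 * a1 - 1 + 2 * norm y) * ((a1 - b) / 2 - norm y)"
        by (simp add: b field_simps)
    qed (use 1 norm_ge_zero[of y] in \<open>(linarith | simp add: b field_simps)+\<close>)
    finally show thesis using 1 by (intro that(1)) (simp_all add: jf flip: E_diag_h1)
  next
    case 2
    have "X \<sim> h1 a1 b 0 0 0 ((- norm y) *\<^sub>R oct_one)"
      using s sim_x3_real[of "- norm y" y a1 b] by (auto simp: dot_square_norm power2_eq_square intro: sim_trans)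
    also have "\<dots> \<sim> h1 0 1 0 0 0 (0 *\<^sub>R oct_one)"
    proof (rule sim_boost[where \<kappa> = "1 - 2 * a1 + 2 * norm y"])
      have "norm y * norm y = a1 * (a1 - 1)"
        by (metis yy dot_square_norm power2_eq_square)
      then show "(0 - 1) / 2 + 0 = (1 - 2 * a1 + 2 * norm y) * ((a1 - b) / 2 - - norm y)"
        by (simp add: b field_simps)
    qed (use 2 norm_ge_zero[of y] in \<open>(linarith | simp add: b field_simps)+\<close>)
    finally show thesis using 2 by (intro that(2)) (simp_all add: jf flip: E_diag_h1)
  qed
qed

lemma null_tr_zero:
  assumes "X \<in> J1" "X \<times>\<^sub>J X = 0" "tr X = 0"
  obtains "X = 0" "jform X (E_diag 1) = 0" | "jform X (E_diag 1) > 0" "X \<sim> P_plus"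
    | "jform X (E_diag 1) < 0" "X \<sim> P_minus"
proof -
  obtain a1 a2 a3 x1 x2 x3 where X: "X = h1 a1 a2 a3 x1 x2 x3" using assms(1) by (rule J1_cases)
  obtain b y where s: "X \<sim> h1 a1 b 0 0 0 y" and y: "a1 * b + y \<bullet> y = 0" and "a1 + b = a1 + a2 + a3"
    using sim_null_reduce[OF assms(2)[unfolded X]] unfolding X by blast
  then have b: "b = - a1"
    using assms(3) by (simp add: X tr_h1)
  have yy: "y \<bullet> y = a1 * a1"
    using y by (simp add: b)
  consider "a1 = 0" | "a1 > 0" | "a1 < 0" by linarith
  then show thesis
  proof cases
    case 1
    then have "X = 0"
      using s yy sim_eq_zero_iff[OF s] by (simp add: b h1_zero)
    moreover have "jform X (E_diag 1) = 0"
      using 1 by (simp only: X jform_E1)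
    ultimately show thesis by (rule that(1))
  next
    case 2
    \<comment> \<open>Here (d, s) is a null vector. The sign of s puts it on the null line that the
      boost carries to that of the target, and only the scale remains to be fitted.\<close>
    have "X \<sim> h1 a1 b 0 0 0 ((- a1) *\<^sub>R oct_one)"
      using s sim_x3_real[of "- a1" y a1 b] by (auto simp: yy intro: sim_trans)
    also have "\<dots> \<sim> h1 1 (-1) 0 0 0 (1 *\<^sub>R oct_one)"
      using 2 by (intro sim_boost[where \<kappa> = "1 / a1"]) (simp_all add: b)
    finally show thesis using 2 that(2) by (simp add: X jform_E1 P_plus_def)
  next
    case 3
    have "X \<sim> h1 a1 b 0 0 0 (a1 *\<^sub>R oct_one)"
      using s sim_x3_real[of a1 y a1 b] by (auto simp: yy intro: sim_trans)
    also have "\<dots> \<sim> h1 (-1) 1 0 0 0 (1 *\<^sub>R oct_one)"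
      using 3 by (intro sim_boost[where \<kappa> = "- a1"]) (simp_all add: b)
    finally show thesis using 3 that(3) by (simp add: X jform_E1 P_minus_def)
  qed
qed

text \<open>
  The Peirce 0-space of \<open>E\<^sub>1\<close> is positive definite, that of \<open>E\<^sub>2\<close> is not.
\<close>

lemma E1_not_sim_E2: "\<not> E_diag 1 \<sim> E_diag 2"
proof
  assume "E_diag 1 \<sim> E_diag 2"
  then obtain g where g: "g \<in> F4_m20" "g (E_diag 2) = E_diag 1"
    using sim_sym by (force simp: sim_def)
  define Y where "Y = h1 0 0 0 0 oct_one 0"
  have Y: "Y \<in> J1" "E_diag 2 \<circ>\<^sub>J Y = 0" "jform Y Y = - 2"
    by (simp_all add: Y_def E_diag_h1 jordan_h1 jform_h1 h1_zero)
  obtain b1 b2 b3 y1 y2 y3 where gY: "g Y = h1 b1 b2 b3 y1 y2 y3"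
    using F4_J1[OF g(1) Y(1)] by (rule J1_cases)
  have "E_diag 1 \<circ>\<^sub>J g Y = 0"
    using F4_jordan[OF g(1) _ Y(1), of "E_diag 2"] g Y by (simp add: F4_zero)
  then have "b1 = 0" "y2 = 0" "y3 = 0"
    by (simp_all add: gY E_diag_h1 jordan_h1 flip: h1_zero)
  then have "jform (g Y) (g Y) \<ge> 0"
    by (simp add: gY jform_h1)
  then show False
    using F4_jform[OF g(1) Y(1,1)] Y(3) by simp
qed

section \<open>Orbits of the idempotents\<close>

lemma E_diag_null:
  "E_diag 1 \<times>\<^sub>J E_diag 1 = 0" "E_diag 2 \<times>\<^sub>J E_diag 2 = 0" "E_diag 3 \<times>\<^sub>J E_diag 3 = 0"
  "tr (E_diag 1) = 1" "tr (E_diag 2) = 1" "tr (E_diag 3) = 1"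
  by (simp_all add: E_diag_h1 cross_self_h1 tr_h1 h1_zero)

lemma E2_sim_E3: "E_diag 2 \<sim> E_diag 3"
  using sim_swap23[of 0 1 0 0 0] by (simp add: E_diag_h1)

text \<open>For the converse, \<open>null_tr_one\<close> leaves two cases, and the wrong one would
  make \<open>E_diag 1\<close> and \<open>E_diag 2\<close> conjugate.\<close>

lemma H_O_iff: "X \<in> H_O \<longleftrightarrow> X \<sim> E_diag 1"
proof
  assume "X \<in> H_O"
  then show "X \<sim> E_diag 1"
    by (auto simp: H_O_def elim: null_tr_one)
next
  assume s: "X \<sim> E_diag 1"
  then have X: "X \<in> J1" "X \<times>\<^sub>J X = 0" "tr X = 1"
    using sim_cross_eq_zero_iff[OF s] sim_tr[OF s] by (simp_all add: sim_J1 E_diag_null)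
  moreover have "\<not> X \<sim> E_diag 2"
    using s E1_not_sim_E2 sim_sym sim_trans by blast
  ultimately show "X \<in> H_O"
    by (auto simp: H_O_def elim: null_tr_one)
qed

lemma H'_O_iff: "X \<in> H'_O \<longleftrightarrow> X \<sim> E_diag 2"
proof
  assume "X \<in> H'_O"
  then show "X \<sim> E_diag 2"
    by (auto simp: H'_O_def elim: null_tr_one)
next
  assume s: "X \<sim> E_diag 2"
  then have X: "X \<in> J1" "X \<times>\<^sub>J X = 0" "tr X = 1"
    using sim_cross_eq_zero_iff[OF s] sim_tr[OF s] by (simp_all add: sim_J1 E_diag_null)
  moreover have "\<not> X \<sim> E_diag 1"
    using s E1_not_sim_E2 sim_sym sim_trans by blast
  ultimately show "X \<in> H'_O"
    by (auto simp: H'_O_def elim: null_tr_one)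
qed

section \<open>Orbits of the null elements of trace zero\<close>

lemma P_plus_in_J1 [simp]: "P_plus \<in> J1" and P_minus_in_J1 [simp]: "P_minus \<in> J1"
  by (simp_all add: P_plus_def P_minus_def)

lemma P_null: "P_plus \<times>\<^sub>J P_plus = 0" "tr P_plus = 0" "P_minus \<times>\<^sub>J P_minus = 0" "tr P_minus = 0"
  by (simp_all add: P_plus_def P_minus_def cross_self_h1 tr_h1 h1_zero)

lemma P_nonzero: "P_plus \<noteq> 0" "P_minus \<noteq> 0"
  by (simp_all add: P_plus_def P_minus_def flip: h1_zero)

lemma P_jform_E1: "jform P_plus (E_diag 1) = 1" "jform P_minus (E_diag 1) = - 1"
  by (simp_all add: P_plus_def P_minus_def jform_E1)

text \<open>A reversed Cauchy-Schwarz inequality: z1 z2 = -|w3|^2 gives (z1 - z2)^2 \<ge> 4 |w3|^2,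
  and z1 - z2 \<ge> 0 on \<open>H_O\<close>.\<close>

lemma jform_P_plus_H_O:
  assumes "Z \<in> H_O"
  shows "jform P_plus Z \<ge> 0"
proof -
  obtain z1 z2 z3 w1 w2 w3 where Z: "Z = h1 z1 z2 z3 w1 w2 w3"
    using assms by (auto simp: H_O_def elim: J1_cases)
  have z: "z1 \<ge> 1" "z1 * z2 + w3 \<bullet> w3 = 0"
    using assms by (auto simp: H_O_def Z jform_E1 cross_self_h1 simp flip: h1_zero)
  define s where "s = oct_one \<bullet> w3"
  have "s\<^sup>2 \<le> w3 \<bullet> w3"
    using Cauchy_Schwarz_ineq[of oct_one w3] by (simp add: s_def)
  moreover have "0 \<le> (z1 + z2)\<^sup>2"
    by simp
  ultimately have "(2 * s)\<^sup>2 \<le> (z1 - z2)\<^sup>2"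
    using z(2) by (simp add: power2_eq_square algebra_simps)
  moreover have "z1 * z2 \<le> 0"
    using z(2) inner_ge_zero[of w3] by linarith
  then have "z2 \<le> 0"
    using z(1) by (auto simp: mult_le_0_iff)
  then have "z1 - z2 \<ge> 0"
    using z(1) by simp
  ultimately have "2 * s \<le> z1 - z2"
    by (metis power2_le_imp_le)
  then show ?thesis
    by (simp add: P_plus_def Z jform_h1 s_def)
qed

lemma N1_plus_iff: "X \<in> N1_plus \<longleftrightarrow> X \<sim> P_plus"
proof
  assume "X \<in> N1_plus"
  then show "X \<sim> P_plus"
    by (auto simp: N1_plus_def elim: null_tr_zero)
next
  assume s: "X \<sim> P_plus"
  then have X: "X \<in> J1" "X \<times>\<^sub>J X = 0" "tr X = 0" "X \<noteq> 0"
    using sim_cross_eq_zero_iff[OF s] sim_tr[OF s] sim_eq_zero_iff[OF s]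
    by (simp_all add: sim_J1 P_null P_nonzero)
  obtain g where g: "g \<in> F4_m20" "g X = P_plus"
    using s by (auto simp: sim_def)
  have "E_diag 1 \<sim> g (E_diag 1)"
    using g by (auto simp: sim_def F4_J1)
  then have "g (E_diag 1) \<in> H_O"
    by (simp add: H_O_iff sim_sym)
  \<comment> \<open>The sign of (X | E_1) is read off from (P^+ | g E_1), where g moves X to P^+;
    the value 0 would force X = 0.\<close>
  then have "jform X (E_diag 1) \<ge> 0"
    using jform_P_plus_H_O[of "g (E_diag 1)"] F4_jform[OF g(1) X(1), of "E_diag 1"] by (simp add: g(2))
  then show "X \<in> N1_plus"
    using null_tr_zero[OF X(1-3)] X by (cases "jform X (E_diag 1) > 0") (auto simp: N1_plus_def)
qed

lemma P_plus_not_sim_P_minus: "\<not> P_plus \<sim> P_minus"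
  using N1_plus_iff[of P_minus] sim_sym by (force simp: N1_plus_def P_jform_E1)

lemma N1_minus_iff: "X \<in> N1_minus \<longleftrightarrow> X \<sim> P_minus"
proof
  assume "X \<in> N1_minus"
  then show "X \<sim> P_minus"
    by (auto simp: N1_minus_def elim: null_tr_zero)
next
  assume s: "X \<sim> P_minus"
  then have X: "X \<in> J1" "X \<times>\<^sub>J X = 0" "tr X = 0" "X \<noteq> 0"
    using sim_cross_eq_zero_iff[OF s] sim_tr[OF s] sim_eq_zero_iff[OF s]
    by (simp_all add: sim_J1 P_null P_nonzero)
  have "\<not> X \<sim> P_plus"
    using s P_plus_not_sim_P_minus sim_sym sim_trans by blast
  then show "X \<in> N1_minus"
    using null_tr_zero[OF X(1-3)] X by (cases "jform X (E_diag 1) < 0") (auto simp: N1_minus_def)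
qed

section \<open>Nilpotent elements of index three\<close>

text \<open>Two involutions with \<open>t = 0\<close>: the first moves \<open>x2\<close> to the
  third slot, the second moves it back, while \<open>x1\<close> undergoes a product of two
  reflections.\<close>

lemma sim_x12_rotate:
  assumes "u \<bullet> u = 1" "v \<bullet> v = 1" "w = (2 * (u \<bullet> x1)) *\<^sub>R u - x1"
  shows "h1 0 0 0 x1 x2 0 \<sim> h1 0 0 0 ((2 * (v \<bullet> w)) *\<^sub>R v - w) (oct_cnj v \<star> (u \<star> x2)) 0"
proof -
  have "h1 0 0 0 x1 x2 0 \<sim> h1 0 0 0 w 0 (oct_cnj (u \<star> x2))"
    using sim_block23[of 0 u 0 0 0 x1 x2 0] assms(1) by (simp add: assms(3))
  also have "\<dots> \<sim> h1 0 0 0 ((2 * (v \<bullet> w)) *\<^sub>R v - w) (oct_cnj v \<star> (u \<star> x2)) 0"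
    using sim_block23[of 0 v 0 0 0 w 0 "oct_cnj (u \<star> x2)"] assms(2) by (simp add: oct_cnj_mult)
  finally show ?thesis .
qed

text \<open>\<open>u\<close> is the normalised bisector of \<open>x\<close> and
  \<open>s *\<^sub>R oct_one\<close>; if these are opposite, any unit vector orthogonal to
  \<open>oct_one\<close> works.\<close>

lemma exists_reflection_to_one:
  fixes x :: "real oct"
  assumes "x \<bullet> x = s * s"
  obtains u where "u \<bullet> u = 1" "(2 * (u \<bullet> x)) *\<^sub>R u - x = s *\<^sub>R oct_one"
proof (cases "x + s *\<^sub>R oct_one = 0")
  case True
  then have x: "x = - (s *\<^sub>R oct_one)"
    by (simp add: eq_neg_iff_add_eq_0)
  have "axis 1 1 \<bullet> (axis 1 1 :: real oct) = 1" "axis 1 1 \<bullet> (oct_one :: real oct) = 0"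
    by (simp_all add: oct_inner oct_one_def axis_def)
  then show thesis
    by (intro that[of "axis 1 1"]) (simp_all add: x)
next
  case False
  define n where "n = x + s *\<^sub>R oct_one"
  have nn: "n \<bullet> n = 2 * (n \<bullet> x)"
    using assms by (simp add: n_def inner_simps inner_commute[of oct_one x] algebra_simps)
  define k where "k = 1 / norm n"
  have k: "k * k * (n \<bullet> n) = 1"
    using False by (simp add: k_def n_def dot_square_norm power2_eq_square)
  then have "2 * (k * (n \<bullet> x)) * k = 1"
    unfolding nn by (simp add: mult_ac)
  then show thesis
    using k by (intro that[of "k *\<^sub>R n"]) (simp_all add: mult.assoc, simp add: n_def)
qed

lemma exists_unit_orthogonal_pair:
  fixes a b :: "real oct"
  obtains u where "u \<bullet> u = 1" "u \<bullet> a = 0" "u \<bullet> b = 0"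
proof -
  have "dim {a, b} < DIM(real oct)"
    using dim_le_card[of "{a, b}" "{a, b}"] card_insert_le_m1[of 2 "{b}" a]
    by (simp add: span_superset)
  then obtain x where x: "x \<noteq> 0" "\<And>y. y \<in> span {a, b} \<Longrightarrow> orthogonal x y"
    using orthogonal_to_subspace_exists by blast
  then have "x \<bullet> a = 0" "x \<bullet> b = 0"
    by (auto simp: orthogonal_def span_base)
  then show thesis
    using x(1) by (intro that[of "(1 / norm x) *\<^sub>R x"]) (simp_all add: dot_square_norm power2_eq_square)
qed

text \<open>
  After \<open>x1\<close> is normalised, \<open>x2\<close> is moved by \<open>x2 \<mapsto> cnj v (u x2)\<close> with imaginary units \<open>u, v\<close>, which fixes a real \<open>x1\<close>:
  every unit octonion is a product of two imaginary units.
\<close>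

lemma sim_x12_real:
  assumes x: "x1 \<bullet> x1 = s * s" "x2 \<bullet> x2 = s * s" and "s \<noteq> 0"
  shows "h1 0 0 0 x1 x2 0 \<sim> h1 0 0 0 (s *\<^sub>R oct_one) (s *\<^sub>R oct_one) 0"
proof -
  obtain u where u: "u \<bullet> u = 1" "(2 * (u \<bullet> x1)) *\<^sub>R u - x1 = s *\<^sub>R oct_one"
    using x(1) by (rule exists_reflection_to_one)
  define y where "y = u \<star> x2"
  have y: "y \<bullet> y = s * s"
    by (simp add: y_def inner_oct_mult_self_left u x)
  have "h1 0 0 0 x1 x2 0 \<sim> h1 0 0 0 (s *\<^sub>R oct_one) y 0"
    using sim_x12_rotate[OF u(1) inner_oct_one_one u(2)[symmetric], of x2]
    by (simp add: y_def scaleR_left_diff_distrib[symmetric])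
  \<comment> \<open>Orthogonality of \<open>w\<close> to \<open>oct_cnj y\<close> makes
    \<open>v\<close> imaginary as well, and \<open>v\<close> is chosen so that
    \<open>oct_cnj v \<star> (w \<star> y)\<close> is |wy|^2 / s = s.\<close>
  also obtain w where w: "w \<bullet> w = 1" "w \<bullet> oct_one = 0" "w \<bullet> oct_cnj y = 0"
    by (rule exists_unit_orthogonal_pair)
  define v where "v = (1 / s) *\<^sub>R (w \<star> y)"
  have v: "v \<bullet> v = 1" "v \<bullet> oct_one = 0"
    using \<open>s \<noteq> 0\<close> w by (simp_all add: v_def inner_oct_mult_self_left y) (simp add: inner_oct_mult_right)
  have "oct_cnj v \<star> (w \<star> y) = s *\<^sub>R oct_one"
    using \<open>s \<noteq> 0\<close> by (simp add: v_def oct_mult_scaleR oct_cnj_mult_self inner_oct_mult_self_left w y)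
  then have "h1 0 0 0 (s *\<^sub>R oct_one) y 0 \<sim> h1 0 0 0 (s *\<^sub>R oct_one) (s *\<^sub>R oct_one) 0"
    using sim_x12_rotate[OF w(1) v(1) refl, of "s *\<^sub>R oct_one" y] w(2) v(2) by simp
  finally show ?thesis .
qed

lemma sim_Q_plus:
  assumes x: "x1 \<bullet> x1 = x2 \<bullet> x2" "x1 \<noteq> 0"
  shows "h1 0 0 0 x1 x2 0 \<sim> Q_plus oct_one"
proof -
  define s where "s = norm x1"
  have s: "s > 0" "x1 \<bullet> x1 = s * s" "x2 \<bullet> x2 = s * s"
    using x by (simp_all add: s_def dot_square_norm power2_eq_square flip: x(1))
  \<comment> \<open>Chosen so that t + r = 1/s, the factor that rescales both entries to length 1.
    The sign of the first entry is corrected afterwards.\<close>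
  define t r where "t = (1 / s + s) / 2" and "r = (1 / s - s) / 2"
  have tr: "t * t - r * r = 1" "t * s + r * s = 1"
    using s(1) by (simp_all add: t_def r_def field_simps)
  have "h1 0 0 0 x1 x2 0 \<sim> h1 0 0 0 (s *\<^sub>R oct_one) (s *\<^sub>R oct_one) 0"
    using s by (intro sim_x12_real) simp_all
  also have "\<dots> \<sim> h1 0 0 0 (- oct_one) oct_one 0"
  proof -
    have "- ((t * s) *\<^sub>R (oct_one :: real oct)) - (r * s) *\<^sub>R oct_one = - ((t * s + r * s) *\<^sub>R oct_one)"
      "(t * s) *\<^sub>R (oct_one :: real oct) + (r * s) *\<^sub>R oct_one = (t * s + r * s) *\<^sub>R oct_one"
      by (simp_all add: scaleR_add_left)
    then show ?thesis
      using sim_block12[OF tr(1), of 0 0 0 "s *\<^sub>R oct_one" "s *\<^sub>R oct_one" 0] by (simp add: tr(2))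
  qed
  also have "\<dots> \<sim> h1 0 0 0 (1 *\<^sub>R oct_one) (1 *\<^sub>R oct_one) 0"
    by (rule sim_x12_real) simp_all
  finally show ?thesis
    by (simp add: Q_plus_def)
qed

text \<open>The adjoint identity \<open>(X \<times> X) \<times> (X \<times> X) = det(X) X\<close>, whose case \<open>x1 = 0\<close> avoids the Moufang identities.\<close>

lemma cross_cross_zero:
  fixes a1 a2 a3 x2 x3
  defines "X \<equiv> h1 a1 a2 a3 0 x2 x3"
  assumes "jdet X = 0"
  shows "(X \<times>\<^sub>J X) \<times>\<^sub>J (X \<times>\<^sub>J X) = 0"
proof -
  have det: "a1 * a2 * a3 + a2 * (x2 \<bullet> x2) + a3 * (x3 \<bullet> x3) = 0"
    using assms(2) by (simp add: X_def jdet_def cross_self_h1 jform_h1 algebra_simps)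
  have "x3 \<star> oct_cnj (x2 \<star> x3) = (x3 \<bullet> x3) *\<^sub>R oct_cnj x2" "oct_cnj (x2 \<star> x3) \<star> x2 = (x2 \<bullet> x2) *\<^sub>R oct_cnj x3"
    by (simp_all add: oct_cnj_mult oct_mult_cnj_self_left oct_mult_cnj_self_right)
  moreover have "oct_cnj (x2 \<star> x3) \<bullet> oct_cnj (x2 \<star> x3) = (x2 \<bullet> x2) * (x3 \<bullet> x3)"
    by (simp add: inner_oct_mult_self_left)
  ultimately have "(X \<times>\<^sub>J X) \<times>\<^sub>J (X \<times>\<^sub>J X) =
      (a1 * a2 * a3 + a2 * (x2 \<bullet> x2) + a3 * (x3 \<bullet> x3)) *\<^sub>R X"
    by (simp add: X_def cross_self_h1 h1_scaleR oct_mult_scaleR)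
      (simp add: vec_eq_iff algebra_simps)
  then show ?thesis by (simp add: det)
qed

text \<open>Treats both normal forms of the cross square at once; positivity of the norm decides the
  sign.\<close>

lemma cross_eq_P:
  assumes tr: "a1 + a2 + a3 = 0" and \<epsilon>: "\<epsilon> * \<epsilon> = 1"
    and X: "h1 a1 a2 a3 x1 x2 x3 \<times>\<^sub>J h1 a1 a2 a3 x1 x2 x3 = h1 \<epsilon> (- \<epsilon>) 0 0 0 oct_one"
  shows "a1 = - a2" "a3 = 0" "x1 \<bullet> x1 = 1" "x2 = oct_cnj x1" "x3 = a2 *\<^sub>R oct_one"
proof -
  have 1: "a2 * a3 - x1 \<bullet> x1 = \<epsilon>" and 2: "a3 * a1 + x2 \<bullet> x2 = - \<epsilon>"
    and 23: "oct_cnj (x2 \<star> x3) = - (a1 *\<^sub>R x1)" and 12: "oct_cnj (x1 \<star> x2) = oct_one + a3 *\<^sub>R x3"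
    using X by (simp_all add: cross_self_h1 diff_eq_eq minus_diff_commute neg_eq_iff_add_eq_0 eq_neg_iff_add_eq_0 add.commute)
  \<comment> \<open>Evaluating \<open>x2 \<star> oct_cnj (x1 \<star> x2)\<close> by alternativity
    and by the equations 12 and 23 expresses \<open>x2\<close> through \<open>x1\<close>.\<close>
  have "(x2 \<bullet> x2) *\<^sub>R oct_cnj x1 = x2 \<star> oct_cnj (x1 \<star> x2)"
    by (simp add: oct_cnj_mult oct_mult_cnj_self_left)
  also have "\<dots> = x2 + a3 *\<^sub>R oct_cnj (oct_cnj (x2 \<star> x3))"
    by (simp add: 12 oct_mult_add oct_mult_scaleR)
  also have "\<dots> = x2 - (a3 * a1) *\<^sub>R oct_cnj x1"
    unfolding 23 by simp
  finally have "x2 = (a3 * a1 + x2 \<bullet> x2) *\<^sub>R oct_cnj x1"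
    by (simp add: scaleR_add_left)
  then have x2: "x2 = - \<epsilon> *\<^sub>R oct_cnj x1"
    unfolding 2 by simp
  then have "x2 \<bullet> x2 = x1 \<bullet> x1"
    using \<epsilon> by simp
  then have "a3 * (a1 + a2) = 0"
    using 1 2 by (simp add: algebra_simps)
  then show a3: "a3 = 0"
    using tr by (auto simp: add_eq_0_iff)
  then show a1: "a1 = - a2"
    using tr by simp
  have n: "x1 \<bullet> x1 = - \<epsilon>"
    using 1 a3 by simp
  \<comment> \<open>-\<epsilon> is a squared norm: this excludes P^+ as a cross square.\<close>
  then have "\<epsilon> = - 1"
    using \<epsilon> inner_ge_zero[of x1] by (auto simp: square_eq_1_iff)
  then show x11: "x1 \<bullet> x1 = 1" and x2': "x2 = oct_cnj x1"
    using n x2 by simp_all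
  have "x3 = x1 \<star> (oct_cnj x1 \<star> x3)"
    by (simp add: oct_mult_cnj_self_left x11)
  also have "oct_cnj x1 \<star> x3 = oct_cnj (a2 *\<^sub>R x1)"
    using arg_cong[OF 23, of oct_cnj] by (simp add: x2' a1)
  finally show "x3 = a2 *\<^sub>R oct_one"
    by (simp add: oct_mult_scaleR oct_mult_cnj x11)
qed

text \<open>
  Write \<open>X = Q\<^sup>+(x) + a P\<^sup>-\<close>. The idempotent \<open>E\<^sub>3 + (a/2) Q\<^sup>+(x) + (a\<^sup>2/4) P\<^sup>-\<close> has \<open>X\<close> in its
  Peirce 1/2-space; moving it to \<open>E\<^sub>3\<close> turns \<open>X\<close> into an element with only \<open>x1, x2\<close> nonzero.
\<close>

lemma sim_Q_plus_of_P_minus: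
  assumes x: "x \<bullet> x = 1"
  shows "h1 (- a) a 0 x (oct_cnj x) (a *\<^sub>R oct_one) \<sim> Q_plus oct_one"
proof -
  define X where "X = h1 (- a) a 0 x (oct_cnj x) (a *\<^sub>R oct_one)"
  define p where "p = h1 (- (a * a / 4)) (a * a / 4) 1 ((a / 2) *\<^sub>R x) ((a / 2) *\<^sub>R oct_cnj x) ((a * a / 4) *\<^sub>R oct_one)"
  have pJ: "p \<in> J1"
    by (simp add: p_def)
  have pX: "p \<circ>\<^sub>J X = (1/2) *\<^sub>R X"
    using x by (simp add: p_def X_def jordan_h1 h1_scaleR oct_mult_scaleR oct_mult_cnj flip: scaleR_2)
      (simp add: vec_eq_iff field_simps)
  have "p \<in> H'_O"
    using x by (simp add: H'_O_def p_def tr_h1 jform_E1 cross_self_h1 oct_mult_scaleR oct_mult_cnj flip: h1_zero)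
  then have "p \<sim> E_diag 3"
    using H'_O_iff E2_sim_E3 sim_trans by blast
  then obtain h where h: "h \<in> F4_m20" "h p = E_diag 3"
    by (auto simp: sim_def)
  have X: "X \<in> J1" "tr X = 0" "tr (X \<times>\<^sub>J X) = 0" "X \<times>\<^sub>J X \<noteq> 0"
    using x by (simp_all add: X_def tr_h1 cross_self_h1 oct_mult_cnj flip: h1_zero)
  obtain b1 b2 b3 y1 y2 y3 where Y: "h X = h1 b1 b2 b3 y1 y2 y3"
    using F4_J1[OF h(1) X(1)] by (rule J1_cases)
  have XY: "X \<sim> h1 b1 b2 b3 y1 y2 y3"
    using h(1) X(1) Y by (auto simp: sim_def)
  have "E_diag 3 \<circ>\<^sub>J h X = (1/2) *\<^sub>R h X"
    using F4_jordan[OF h(1) pJ X(1)] F4_scaleR[OF h(1) X(1)] by (simp add: h(2) pX)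
  then have 0: "b1 = 0" "b2 = 0" "b3 = 0" "y3 = 0"
    by (simp_all add: Y E_diag_h1 jordan_h1 h1_scaleR)
  \<comment> \<open>Only the entries \<open>y1\<close> and \<open>y2\<close> survive; tr(X \<times>
    X) = 0 makes their norms equal, and X \<times> X \<noteq> 0 makes them nonzero.\<close>
  have "y1 \<bullet> y1 = y2 \<bullet> y2"
    using sim_tr[OF sim_cross[OF XY]] X(3) by (simp add: 0 cross_self_h1 tr_h1)
  moreover from this have "y1 \<noteq> 0"
    using sim_cross_eq_zero_iff[OF XY] X(4) by (auto simp: 0 cross_self_h1 h1_zero)
  ultimately show ?thesis
    using XY sim_Q_plus sim_trans unfolding 0 X_def by blast
qed

lemma N2_iff: "X \<in> N2 \<longleftrightarrow> X \<sim> Q_plus oct_one"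
proof
  assume "X \<in> N2"
  then have X: "X \<in> J1" "tr X = 0" "tr (X \<times>\<^sub>J X) = 0" "jdet X = 0" "X \<times>\<^sub>J X \<noteq> 0"
    by (simp_all add: N2_def)
  \<comment> \<open>Diagonalising first makes \<open>cross_cross_zero\<close> applicable, so that
    the cross square is null.\<close>
  obtain a1 a2 a3 x2 x3 where XY: "X \<sim> h1 a1 a2 a3 0 x2 x3"
    using X(1) sim_x1_zero by (elim J1_cases) metis
  define Y where "Y = h1 a1 a2 a3 0 x2 x3"
  have "jdet Y = 0" "tr (Y \<times>\<^sub>J Y) = 0" "Y \<times>\<^sub>J Y \<noteq> 0" "Y \<in> J1"
    using X sim_jdet[OF XY] sim_tr[OF sim_cross[OF XY]] sim_cross_eq_zero_iff[OF XY] by (simp_all add: Y_def)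
  moreover from this have "(Y \<times>\<^sub>J Y) \<times>\<^sub>J (Y \<times>\<^sub>J Y) = 0"
    by (simp add: Y_def cross_cross_zero)
  ultimately have "Y \<times>\<^sub>J Y \<sim> P_plus \<or> Y \<times>\<^sub>J Y \<sim> P_minus"
    using null_tr_zero[of "Y \<times>\<^sub>J Y"] J1_cross by blast
  \<comment> \<open>\<epsilon> = 1 encodes \<open>P_plus\<close> and \<epsilon> = -1 encodes
    \<open>P_minus\<close>.\<close>
  then obtain \<epsilon> :: real where \<epsilon>: "\<epsilon> * \<epsilon> = 1" "Y \<times>\<^sub>J Y \<sim> h1 \<epsilon> (- \<epsilon>) 0 0 0 oct_one"
    unfolding P_plus_def P_minus_def by (metis minus_minus mult_1 mult_minus1 mult_minus_left)
  then obtain g where g: "g \<in> F4_m20" "g (Y \<times>\<^sub>J Y) = h1 \<epsilon> (- \<epsilon>) 0 0 0 oct_one"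
    by (auto simp: sim_def)
  obtain b1 b2 b3 y1 y2 y3 where Z: "g Y = h1 b1 b2 b3 y1 y2 y3"
    using F4_J1[OF g(1) \<open>Y \<in> J1\<close>] by (rule J1_cases)
  have YZ: "Y \<sim> h1 b1 b2 b3 y1 y2 y3"
    using g(1) Z \<open>Y \<in> J1\<close> by (auto simp: sim_def)
  have tr0: "b1 + b2 + b3 = 0"
    using sim_tr[OF YZ] sim_tr[OF XY] X(2) by (simp add: tr_h1 Y_def)
  have "h1 b1 b2 b3 y1 y2 y3 \<times>\<^sub>J h1 b1 b2 b3 y1 y2 y3 = h1 \<epsilon> (- \<epsilon>) 0 0 0 oct_one"
    using F4_cross[OF g(1) \<open>Y \<in> J1\<close> \<open>Y \<in> J1\<close>] g(2) Z by simp
  note * = cross_eq_P[OF tr0 \<epsilon>(1) this]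
  have "h1 b1 b2 b3 y1 y2 y3 \<sim> Q_plus oct_one"
    using sim_Q_plus_of_P_minus[OF *(3), of b2] by (simp only: *(1,2,4,5))
  then show "X \<sim> Q_plus oct_one"
    using XY YZ sim_trans unfolding Y_def by blast
next
  assume s: "X \<sim> Q_plus oct_one"
  have "tr (Q_plus oct_one) = 0" "tr (Q_plus oct_one \<times>\<^sub>J Q_plus oct_one) = 0" "jdet (Q_plus oct_one) = 0"
    "Q_plus oct_one \<times>\<^sub>J Q_plus oct_one \<noteq> 0"
    by (simp_all add: Q_plus_def cross_self_h1 tr_h1 jdet_def jform_h1 flip: h1_zero)
  then show "X \<in> N2"
    using sim_J1(1)[OF s] sim_tr[OF s] sim_jdet[OF s] sim_tr[OF sim_cross[OF s]] sim_cross_eq_zero_iff[OF s]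
    by (simp add: N2_def)
qed

theorem proposition0p1:
  shows
    "H_O = Orb F4_m20 (E_diag 1) \<and>
     (H'_O = Orb F4_m20 (E_diag 2) \<and> Orb F4_m20 (E_diag 2) = Orb F4_m20 (E_diag 3)) \<and>
     N1_plus = Orb F4_m20 P_plus \<and>
     N1_minus = Orb F4_m20 P_minus \<and>
     N2 = Orb F4_m20 (Q_plus oct_one)"
proof -
  have Q: "Q_plus oct_one \<in> J1"
    by (simp add: Q_plus_def)
  have "E_diag 2 \<sim> X \<longleftrightarrow> E_diag 3 \<sim> X" for X
    using E2_sim_E3 sim_sym sim_trans by blast
  moreover have "X \<sim> Y \<longleftrightarrow> Y \<sim> X" for X Y
    using sim_sym by blast
  ultimately show ?thesis
    by (auto simp: Orb_F4 Q H_O_iff H'_O_iff N1_plus_iff N1_minus_iff N2_iff)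
qed

end
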